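(* Let $V$ be a commutative valuation domain with quotient field $F$, $K/F$ a finite Galois extension with group $G$, $S$ the integral closure of $V$ in $K$, $f:G\times G\to S\setminus\{0\}$ a normalized $2$-cocycle, and $N$ a maximal ideal of $S$. (1) The graph homomorphism $\psi_N:\mathrm{Gr}(f_N)\to\mathrm{Gr}(f^N)$ is an isomorphism if and only if there exists a set of right coset representatives $\sigma_1,\ldots,\sigma_r$ of $G^Z(S_N\mid F)$ in $G$ such that $f(\sigma_i,\sigma_i^{-1})\notin N$ for all $i$. When this happens, $\phi_N$ is a well-defined graph epimorphism and $\psi_N\circ\phi_N=c_N$. (2) If $\psi_N$ is a graph isomorphism and $M$ is another maximal ideal of $S$, then (a) the graphs $\mathrm{Gr}(f^M)$, $\mathrm{Gr}(f^N)$, $\mathrm{Gr}(f_M)$ and $\mathrm{Gr}(f_N)$ are all isomorphic, and (b) $\psi_M$ is also a graph isomorphism. In particular, if $K/F$ is tamely ramified and defectless and $A_f$ is primary, then $\psi_N$ is a graph isomorphism, $\psi_N\circ\phi_N=c_N$, and as $M$ ranges over all maximal ideals of $S$ the graphs $\mathrm{Gr}(f^M)$ and $\mathrm{Gr}(f_M)$ are all isomorphic to one another.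
   Context: $V$ has arbitrary Krull dimension. A normalized 2-cocycle satisfies $\sigma(f(\tau,\gamma))f(\sigma,\tau\gamma)=f(\sigma,\tau)f(\sigma\tau,\gamma)$, $f(1,\sigma)=f(\sigma,1)=1$; values need not be units. $A_f=\bigoplus_{\sigma\in G}Sx_\sigma$ with $(sx_\sigma)(tx_\tau)=s\,\sigma(t)f(\sigma,\tau)x_{\sigma\tau}$; it is primary if $J(A_f)$ is a maximal ideal. $H=\{\sigma\in G:f(\sigma,\sigma^{-1})\in U(S)\}$. $\mathrm{Gr}(f)$: partial order on the left coset space $G/H$, $\sigma H\le\tau H$ iff $f(\sigma,\sigma^{-1}\tau)\in U(S)$. For a maximal ideal $M$ of $S$: $\sigma H\le_M\tau H$ iff $f(\sigma,\sigma^{-1}\tau)\notin M$ is a well-defined preorder on $G/H$; $[\sigma]_M$ denotes the class of $\sigma H$ under the equivalence "$\le_M$ both ways", and $\mathrm{Gr}(f^M)$ is the induced partial order on these classes. $G^Z=G^Z(S_M\mid F)=\{\sigma\in G:\sigma(S_M)\subseteq S_M\}$; $f_M$ is the restriction of $f$ to $G^Z\times G^Z$; $H_M=\{\sigma\in G^Z: f(\sigma,\sigma^{-1})\notin M\}$ (a subgroup); $\mathrm{Gr}(f_M)$ is the partial order on $G^Z/H_M$ given by $\sigma H_M\le\tau H_M$ iff $f(\sigma,\sigma^{-1}\tau)\notin M$. Graph homomorphism = order-preserving map; isomorphism = bijection preserving and reflecting order; epimorphism = surjective homomorphism. $\psi_M:\mathrm{Gr}(f_M)\to\mathrm{Gr}(f^M)$,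 $\sigma H_M\mapsto[\sigma]_M$ ($\sigma\in G^Z$), is a well-defined injective graph homomorphism. $c_M:\mathrm{Gr}(f)\to\mathrm{Gr}(f^M)$, $\sigma H\mapsto[\sigma]_M$. $\phi_N:\mathrm{Gr}(f)\to\mathrm{Gr}(f_N)$, $\sigma H\mapsto dH_N$ where $d\in G^Z(S_N\mid F)$ satisfies $f(d^{-1}\sigma,\sigma^{-1}d)\notin N$. Tamely ramified and defectless: $e=[\Gamma_{S_M}:\Gamma_V]$, $r$ = number of maximal ideals of $S$, $[K:F]=e[\overline{S_M}:\overline V]r$, $\mathrm{char}\,\overline V\nmid e$, $\overline{S_M}/\overline V$ separable. *)

theory Defs
  imports "HOL-Computational_Algebra.Polynomial"
begin

section \<open>Setting: K is the whole field type 'k, G a finite group of automorphisms of K,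
  F the fixed field of G (so K/F is finite Galois with group G by Artin's theorem)\<close>

type_synonym 'k aut = "'k \<Rightarrow> 'k"

definition aut_group :: "'k::field aut set \<Rightarrow> bool" where
  "aut_group G \<longleftrightarrow> finite G \<and> id \<in> G
     \<and> (\<forall>\<sigma>\<in>G. bij \<sigma> \<and> \<sigma> 1 = 1 \<and> (\<forall>x y. \<sigma> (x + y) = \<sigma> x + \<sigma> y) \<and> (\<forall>x y. \<sigma> (x * y) = \<sigma> x * \<sigma> y))
     \<and> (\<forall>\<sigma>\<in>G. \<forall>\<tau>\<in>G. \<sigma> \<circ> \<tau> \<in> G) \<and> (\<forall>\<sigma>\<in>G. inv \<sigma> \<in> G)"

definition fixfield :: "'k aut set \<Rightarrow> 'k set" where
  "fixfield G = {x. \<forall>\<sigma>\<in>G. \<sigma> x = x}"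

definition valuation_domain_of :: "'k::field set \<Rightarrow> 'k set \<Rightarrow> bool" where
  "valuation_domain_of F V \<longleftrightarrow> V \<subseteq> F \<and> 0 \<in> V \<and> 1 \<in> V
     \<and> (\<forall>x\<in>V. \<forall>y\<in>V. x + y \<in> V \<and> x * y \<in> V) \<and> (\<forall>x\<in>V. - x \<in> V)
     \<and> (\<forall>x\<in>F. x \<noteq> 0 \<longrightarrow> x \<in> V \<or> inverse x \<in> V)"

definition int_closure :: "'k::field set \<Rightarrow> 'k set" where
  "int_closure V = {x. \<exists>p. lead_coeff p = 1 \<and> (\<forall>i. coeff p i \<in> V) \<and> poly p x = 0}"

definition units_of_sub :: "'k::field set \<Rightarrow> 'k set" where
  "units_of_sub R = {x \<in> R. x \<noteq> 0 \<and> inverse x \<in> R}"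

definition ideal_of :: "'k::field set \<Rightarrow> 'k set \<Rightarrow> bool" where
  "ideal_of R I \<longleftrightarrow> I \<subseteq> R \<and> 0 \<in> I \<and> (\<forall>x\<in>I. \<forall>y\<in>I. x + y \<in> I) \<and> (\<forall>r\<in>R. \<forall>x\<in>I. r * x \<in> I)"

definition max_ideal_of :: "'k::field set \<Rightarrow> 'k set \<Rightarrow> bool" where
  "max_ideal_of R M \<longleftrightarrow> ideal_of R M \<and> M \<noteq> R \<and> (\<forall>I. ideal_of R I \<and> M \<subseteq> I \<longrightarrow> I = M \<or> I = R)"

definition localize :: "'k::field set \<Rightarrow> 'k set \<Rightarrow> 'k set" where
  "localize R M = {x. \<exists>a\<in>R. \<exists>t\<in>R - M. x = a / t}"

definition loc_max :: "'k::field set \<Rightarrow> 'k set \<Rightarrow> 'k set" where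
  "loc_max R M = {x. \<exists>a\<in>M. \<exists>t\<in>R - M. x = a / t}"

definition decomp_group :: "'k::field aut set \<Rightarrow> 'k set \<Rightarrow> 'k set \<Rightarrow> 'k aut set" where
  "decomp_group G S M = {\<sigma>\<in>G. \<sigma> ` localize S M \<subseteq> localize S M}"

definition norm_cocycle :: "'k::field aut set \<Rightarrow> 'k set \<Rightarrow> ('k aut \<Rightarrow> 'k aut \<Rightarrow> 'k) \<Rightarrow> bool" where
  "norm_cocycle G S f \<longleftrightarrow> (\<forall>\<sigma>\<in>G. \<forall>\<tau>\<in>G. f \<sigma> \<tau> \<in> S - {0})
     \<and> (\<forall>\<sigma>\<in>G. \<forall>\<tau>\<in>G. \<forall>\<gamma>\<in>G. \<sigma> (f \<tau> \<gamma>) * f \<sigma> (\<tau> \<circ> \<gamma>) = f \<sigma> \<tau> * f (\<sigma> \<circ> \<tau>) \<gamma>)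
     \<and> (\<forall>\<sigma>\<in>G. f id \<sigma> = 1 \<and> f \<sigma> id = 1)"

section \<open>Graphs (= partially ordered sets) and their morphisms\<close>

type_synonym 'a graph = "'a set \<times> ('a \<Rightarrow> 'a \<Rightarrow> bool)"

definition graph_hom :: "('a \<Rightarrow> 'b) \<Rightarrow> 'a graph \<Rightarrow> 'b graph \<Rightarrow> bool" where
  "graph_hom h g1 g2 \<longleftrightarrow> (\<forall>x\<in>fst g1. h x \<in> fst g2)
     \<and> (\<forall>x\<in>fst g1. \<forall>y\<in>fst g1. snd g1 x y \<longrightarrow> snd g2 (h x) (h y))"

definition graph_iso :: "('a \<Rightarrow> 'b) \<Rightarrow> 'a graph \<Rightarrow> 'b graph \<Rightarrow> bool" where
  "graph_iso h g1 g2 \<longleftrightarrow> graph_hom h g1 g2 \<and> bij_betw h (fst g1) (fst g2)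
     \<and> (\<forall>x\<in>fst g1. \<forall>y\<in>fst g1. snd g2 (h x) (h y) \<longrightarrow> snd g1 x y)"

definition graph_epi :: "('a \<Rightarrow> 'b) \<Rightarrow> 'a graph \<Rightarrow> 'b graph \<Rightarrow> bool" where
  "graph_epi h g1 g2 \<longleftrightarrow> graph_hom h g1 g2 \<and> h ` fst g1 = fst g2"

definition graph_isomorphic :: "'a graph \<Rightarrow> 'b graph \<Rightarrow> bool" where
  "graph_isomorphic g1 g2 \<longleftrightarrow> (\<exists>h. graph_iso h g1 g2)"

definition lcoset :: "'k aut \<Rightarrow> 'k aut set \<Rightarrow> 'k aut set" where
  "lcoset \<sigma> H = (\<lambda>h. \<sigma> \<circ> h) ` H"

definition Hgrp :: "'k::field aut set \<Rightarrow> 'k set \<Rightarrow> ('k aut \<Rightarrow> 'k aut \<Rightarrow> 'k) \<Rightarrow> 'k aut set" where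
  "Hgrp G S f = {\<sigma>\<in>G. f \<sigma> (inv \<sigma>) \<in> units_of_sub S}"

definition Gr :: "'k::field aut set \<Rightarrow> 'k set \<Rightarrow> ('k aut \<Rightarrow> 'k aut \<Rightarrow> 'k) \<Rightarrow> 'k aut set graph" where
  "Gr G S f = ({lcoset \<sigma> (Hgrp G S f) | \<sigma>. \<sigma> \<in> G},
     \<lambda>X Y. \<exists>\<sigma>\<in>G. \<exists>\<tau>\<in>G. X = lcoset \<sigma> (Hgrp G S f) \<and> Y = lcoset \<tau> (Hgrp G S f)
              \<and> f \<sigma> (inv \<sigma> \<circ> \<tau>) \<in> units_of_sub S)"

definition leM :: "('k::field aut \<Rightarrow> 'k aut \<Rightarrow> 'k) \<Rightarrow> 'k set \<Rightarrow> 'k aut \<Rightarrow> 'k aut \<Rightarrow> bool" where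
  "leM f M \<sigma> \<tau> \<longleftrightarrow> f \<sigma> (inv \<sigma> \<circ> \<tau>) \<notin> M"

definition clsM :: "'k::field aut set \<Rightarrow> 'k set \<Rightarrow> ('k aut \<Rightarrow> 'k aut \<Rightarrow> 'k) \<Rightarrow> 'k set \<Rightarrow> 'k aut \<Rightarrow> 'k aut set set" where
  "clsM G S f M \<sigma> = {lcoset \<tau> (Hgrp G S f) | \<tau>. \<tau> \<in> G \<and> leM f M \<sigma> \<tau> \<and> leM f M \<tau> \<sigma>}"

definition GrSup :: "'k::field aut set \<Rightarrow> 'k set \<Rightarrow> ('k aut \<Rightarrow> 'k aut \<Rightarrow> 'k) \<Rightarrow> 'k set \<Rightarrow> 'k aut set set graph" where
  "GrSup G S f M = ({clsM G S f M \<sigma> | \<sigma>. \<sigma> \<in> G},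
     \<lambda>A B. \<exists>\<sigma>\<in>G. \<exists>\<tau>\<in>G. A = clsM G S f M \<sigma> \<and> B = clsM G S f M \<tau> \<and> leM f M \<sigma> \<tau>)"

definition HM :: "'k::field aut set \<Rightarrow> 'k set \<Rightarrow> ('k aut \<Rightarrow> 'k aut \<Rightarrow> 'k) \<Rightarrow> 'k set \<Rightarrow> 'k aut set" where
  "HM G S f M = {\<sigma>\<in>decomp_group G S M. f \<sigma> (inv \<sigma>) \<notin> M}"

definition GrSub :: "'k::field aut set \<Rightarrow> 'k set \<Rightarrow> ('k aut \<Rightarrow> 'k aut \<Rightarrow> 'k) \<Rightarrow> 'k set \<Rightarrow> 'k aut set graph" where
  "GrSub G S f M = ({lcoset \<sigma> (HM G S f M) | \<sigma>. \<sigma> \<in> decomp_group G S M},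
     \<lambda>X Y. \<exists>\<sigma>\<in>decomp_group G S M. \<exists>\<tau>\<in>decomp_group G S M.
              X = lcoset \<sigma> (HM G S f M) \<and> Y = lcoset \<tau> (HM G S f M) \<and> f \<sigma> (inv \<sigma> \<circ> \<tau>) \<notin> M)"

definition psiM :: "'k::field aut set \<Rightarrow> 'k set \<Rightarrow> ('k aut \<Rightarrow> 'k aut \<Rightarrow> 'k) \<Rightarrow> 'k set \<Rightarrow> 'k aut set \<Rightarrow> 'k aut set set" where
  "psiM G S f M X = clsM G S f M (SOME \<sigma>. \<sigma> \<in> decomp_group G S M \<and> X = lcoset \<sigma> (HM G S f M))"

definition cM :: "'k::field aut set \<Rightarrow> 'k set \<Rightarrow> ('k aut \<Rightarrow> 'k aut \<Rightarrow> 'k) \<Rightarrow> 'k set \<Rightarrow> 'k aut set \<Rightarrow> 'k aut set set" where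
  "cM G S f M X = clsM G S f M (SOME \<sigma>. \<sigma> \<in> G \<and> X = lcoset \<sigma> (Hgrp G S f))"

definition phi_cond :: "'k::field aut set \<Rightarrow> 'k set \<Rightarrow> ('k aut \<Rightarrow> 'k aut \<Rightarrow> 'k) \<Rightarrow> 'k set \<Rightarrow> 'k aut \<Rightarrow> 'k aut \<Rightarrow> bool" where
  "phi_cond G S f N \<sigma> d \<longleftrightarrow> d \<in> decomp_group G S N \<and> f (inv d \<circ> \<sigma>) (inv \<sigma> \<circ> d) \<notin> N"

text \<open>\<phi>_N : Gr(f) \<rightarrow> Gr(f_N), \<sigma>H \<mapsto> dH_N (choices made by Hilbert choice;
  well-definedness is stated separately in the theorem).\<close>
definition phiN :: "'k::field aut set \<Rightarrow> 'k set \<Rightarrow> ('k aut \<Rightarrow> 'k aut \<Rightarrow> 'k) \<Rightarrow> 'k set \<Rightarrow> 'k aut set \<Rightarrow> 'k aut set" where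
  "phiN G S f N X =
     (let \<sigma> = (SOME \<sigma>. \<sigma> \<in> G \<and> X = lcoset \<sigma> (Hgrp G S f))
      in lcoset (SOME d. phi_cond G S f N \<sigma> d) (HM G S f N))"

definition phi_well_defined :: "'k::field aut set \<Rightarrow> 'k set \<Rightarrow> ('k aut \<Rightarrow> 'k aut \<Rightarrow> 'k) \<Rightarrow> 'k set \<Rightarrow> bool" where
  "phi_well_defined G S f N \<longleftrightarrow>
     (\<forall>\<sigma>\<in>G. \<exists>d. phi_cond G S f N \<sigma> d)
     \<and> (\<forall>\<sigma>\<in>G. \<forall>\<sigma>'\<in>G. \<forall>d d'. lcoset \<sigma> (Hgrp G S f) = lcoset \<sigma>' (Hgrp G S f)
          \<and> phi_cond G S f N \<sigma> d \<and> phi_cond G S f N \<sigma>' d'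
          \<longrightarrow> lcoset d (HM G S f N) = lcoset d' (HM G S f N))"

definition right_coset_reps :: "'k aut set \<Rightarrow> 'k aut set \<Rightarrow> 'k aut set \<Rightarrow> bool" where
  "right_coset_reps G Z R \<longleftrightarrow> R \<subseteq> G \<and> (\<forall>\<sigma>\<in>G. \<exists>!\<rho>. \<rho> \<in> R \<and> \<rho> \<in> (\<lambda>z. z \<circ> \<sigma>) ` Z)"

text \<open>Elements of A_f = \<Oplus> S x_\<sigma> are represented as coefficient functions G \<rightarrow> S
  (zero outside G).\<close>
definition cp_carrier :: "'k::field aut set \<Rightarrow> 'k set \<Rightarrow> ('k aut \<Rightarrow> 'k) set" where
  "cp_carrier G S = {a. (\<forall>\<sigma>\<in>G. a \<sigma> \<in> S) \<and> (\<forall>\<sigma>. \<sigma> \<notin> G \<longrightarrow> a \<sigma> = 0)}"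

definition cp_mult :: "'k::field aut set \<Rightarrow> ('k aut \<Rightarrow> 'k aut \<Rightarrow> 'k) \<Rightarrow> ('k aut \<Rightarrow> 'k) \<Rightarrow> ('k aut \<Rightarrow> 'k) \<Rightarrow> ('k aut \<Rightarrow> 'k)" where
  "cp_mult G f a b = (\<lambda>\<rho>. if \<rho> \<in> G then (\<Sum>\<sigma>\<in>G. a \<sigma> * \<sigma> (b (inv \<sigma> \<circ> \<rho>)) * f \<sigma> (inv \<sigma> \<circ> \<rho>)) else 0)"

definition cp_left_ideal :: "'k::field aut set \<Rightarrow> 'k set \<Rightarrow> ('k aut \<Rightarrow> 'k aut \<Rightarrow> 'k) \<Rightarrow> ('k aut \<Rightarrow> 'k) set \<Rightarrow> bool" where
  "cp_left_ideal G S f L \<longleftrightarrow> L \<subseteq> cp_carrier G S \<and> (\<lambda>_. 0) \<in> L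
     \<and> (\<forall>x\<in>L. \<forall>y\<in>L. (\<lambda>\<rho>. x \<rho> + y \<rho>) \<in> L)
     \<and> (\<forall>a\<in>cp_carrier G S. \<forall>x\<in>L. cp_mult G f a x \<in> L)"

definition cp_ideal :: "'k::field aut set \<Rightarrow> 'k set \<Rightarrow> ('k aut \<Rightarrow> 'k aut \<Rightarrow> 'k) \<Rightarrow> ('k aut \<Rightarrow> 'k) set \<Rightarrow> bool" where
  "cp_ideal G S f I \<longleftrightarrow> cp_left_ideal G S f I \<and> (\<forall>a\<in>cp_carrier G S. \<forall>x\<in>I. cp_mult G f x a \<in> I)"

definition cp_max_left_ideal :: "'k::field aut set \<Rightarrow> 'k set \<Rightarrow> ('k aut \<Rightarrow> 'k aut \<Rightarrow> 'k) \<Rightarrow> ('k aut \<Rightarrow> 'k) set \<Rightarrow> bool" where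
  "cp_max_left_ideal G S f L \<longleftrightarrow> cp_left_ideal G S f L \<and> L \<noteq> cp_carrier G S
     \<and> (\<forall>L'. cp_left_ideal G S f L' \<and> L \<subseteq> L' \<longrightarrow> L' = L \<or> L' = cp_carrier G S)"

definition cp_max_ideal :: "'k::field aut set \<Rightarrow> 'k set \<Rightarrow> ('k aut \<Rightarrow> 'k aut \<Rightarrow> 'k) \<Rightarrow> ('k aut \<Rightarrow> 'k) set \<Rightarrow> bool" where
  "cp_max_ideal G S f I \<longleftrightarrow> cp_ideal G S f I \<and> I \<noteq> cp_carrier G S
     \<and> (\<forall>I'. cp_ideal G S f I' \<and> I \<subseteq> I' \<longrightarrow> I' = I \<or> I' = cp_carrier G S)"

definition cp_jacobson :: "'k::field aut set \<Rightarrow> 'k set \<Rightarrow> ('k aut \<Rightarrow> 'k aut \<Rightarrow> 'k) \<Rightarrow> ('k aut \<Rightarrow> 'k) set" where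
  "cp_jacobson G S f = {a \<in> cp_carrier G S. \<forall>L. cp_max_left_ideal G S f L \<longrightarrow> a \<in> L}"

definition primary_cp :: "'k::field aut set \<Rightarrow> 'k set \<Rightarrow> ('k aut \<Rightarrow> 'k aut \<Rightarrow> 'k) \<Rightarrow> bool" where
  "primary_cp G S f \<longleftrightarrow> cp_max_ideal G S f (cp_jacobson G S f)"

text \<open>e = [\<Gamma>_{S_M} : \<Gamma>_V] = index of F^* U(S_M) in K^*.\<close>
definition ram_index :: "'k::field aut set \<Rightarrow> 'k set \<Rightarrow> 'k set \<Rightarrow> nat" where
  "ram_index G S M = card {(\<lambda>y. x * y) ` {a * u | a u. a \<in> fixfield G - {0} \<and> u \<in> units_of_sub (localize S M)} | x. x \<noteq> 0}"

definition val_max :: "'k::field set \<Rightarrow> 'k set" where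
  "val_max V = V - units_of_sub V"

text \<open>Residue degree [S_M/MS_M : V/J(V)]: maximal number of elements of S_M whose residues
  are linearly independent over the residue field of V.\<close>
definition res_indep :: "'k::field set \<Rightarrow> 'k set \<Rightarrow> 'k set \<Rightarrow> nat \<Rightarrow> (nat \<Rightarrow> 'k) \<Rightarrow> bool" where
  "res_indep V S M n s \<longleftrightarrow> (\<forall>i<n. s i \<in> localize S M)
     \<and> (\<forall>c. (\<forall>i<n. c i \<in> V) \<and> (\<Sum>i<n. c i * s i) \<in> loc_max S M \<longrightarrow> (\<forall>i<n. c i \<in> val_max V))"

definition res_degree :: "'k::field set \<Rightarrow> 'k set \<Rightarrow> 'k set \<Rightarrow> nat" where
  "res_degree V S M = (GREATEST n. \<exists>s. res_indep V S M n s)"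

definition res_char :: "'k::field set \<Rightarrow> nat" where
  "res_char V = (if \<exists>n>0. of_nat n \<in> val_max V then (LEAST n. n > 0 \<and> of_nat n \<in> val_max V) else 0)"

text \<open>Separability of S_M/MS_M over V/J(V): every residue class is a simple root of
  (the reduction of) a polynomial with coefficients in V.\<close>
definition res_separable :: "'k::field set \<Rightarrow> 'k set \<Rightarrow> 'k set \<Rightarrow> bool" where
  "res_separable V S M \<longleftrightarrow> (\<forall>a\<in>localize S M. \<exists>p. (\<forall>i. coeff p i \<in> V)
      \<and> poly p a \<in> loc_max S M \<and> poly (pderiv p) a \<notin> loc_max S M)"

definition tame_defectless :: "'k::field aut set \<Rightarrow> 'k set \<Rightarrow> bool" where
  "tame_defectless G V \<longleftrightarrow> (\<exists>M. max_ideal_of (int_closure V) M \<and>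
     card G = ram_index G (int_closure V) M * res_degree V (int_closure V) M
                 * card {M'. max_ideal_of (int_closure V) M'}
     \<and> \<not> (res_char V dvd ram_index G (int_closure V) M)
     \<and> res_separable V (int_closure V) M)"

end

theory Submission
  imports Defs
begin

text \<open>
  A class of \<open>\<sigma>\<close> under the preorder of N meets the decomposition group Z of N in d iff
  \<open>\<rho> = d\<^sup>-\<^sup>1 \<sigma>\<close> satisfies \<open>f(\<rho>, \<rho>\<^sup>-\<^sup>1) \<notin> N\<close>; hence \<open>\<psi>\<^sub>N\<close> is onto iff every right
  coset of Z contains such a \<open>\<rho>\<close>, and it always preserves and reflects the order.
  The Galois group permutes the maximal ideals of S transitively, and a good representative lets one
  write \<open>M = \<omega> N\<close> with \<open>f(\<omega>, \<omega>\<^sup>-\<^sup>1) \<notin> M\<close>; left translation by \<open>\<omega>\<close> then carries everything from N to M.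

  Suppose \<open>A\<^sub>f\<close> is primary, and choose e in every maximal ideal of S except N. If no \<open>\<sigma>\<close> with
  \<open>\<sigma> N = M\<close> had \<open>f(\<sigma>, \<sigma>\<^sup>-\<^sup>1) \<notin> M\<close>, then the identity coefficient of every element of the ideal
  generated by e would lie in M. So e would generate a proper ideal, hence lie in the Jacobson radical,
  whereas e is a unit modulo the proper left ideal \<open>A\<^sub>f N\<close>.
\<close>

section \<open>Integral closure\<close>

text \<open>The criterion in \<open>f \<rho> (inv \<rho>)\<close> comes from one instance of the
  cocycle identity: the two values that compare \<sigma> with \<tau> in both directions multiply to
  the image under \<sigma> of \<open>f \<rho> (inv \<rho>)\<close>, where \<rho> is
  \<open>inv \<sigma> \<circ> \<tau>\<close>. As V may have any Krull dimension, neither Noetherian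
  arguments nor finite generation of S over V can be relied on. The ring structure of S and the
  action of G on its maximal ideals are therefore derived from integral equations, and maximal left
  ideals of A_f come from Zorn's lemma. The Jacobson radical of A_f is never computed. It lies in
  every maximal left ideal, so its sum with a proper two-sided ideal is still proper; when the
  radical is a maximal ideal it therefore contains every proper two-sided ideal. This is how e is
  forced into it.\<close>

definition subring_set :: "'k::comm_ring_1 set \<Rightarrow> bool" where
  "subring_set V \<longleftrightarrow> 0 \<in> V \<and> 1 \<in> V \<and> (\<forall>x\<in>V. \<forall>y\<in>V. x + y \<in> V \<and> x * y \<in> V) \<and> (\<forall>x\<in>V. - x \<in> V)"

lemma subring_setD:
  assumes "subring_set V"
  shows "0 \<in> V" "1 \<in> V" "x \<in> V \<Longrightarrow> y \<in> V \<Longrightarrow> x + y \<in> V" "x \<in> V \<Longrightarrow> y \<in> V \<Longrightarrow> x * y \<in> V" "x \<in> V \<Longrightarrow> - x \<in> V"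
  using assms unfolding subring_set_def by auto

lemma subring_set_sum:
  assumes "subring_set V" "\<And>i. i \<in> I \<Longrightarrow> g i \<in> V"
  shows "sum g I \<in> V"
  using assms(2) by (induction I rule: infinite_finite_induct) (auto intro: subring_setD[OF assms(1)])

lemma subring_set_prod:
  assumes "subring_set V" "\<And>i. i \<in> I \<Longrightarrow> g i \<in> V"
  shows "prod g I \<in> V"
  using assms(2) by (induction I rule: infinite_finite_induct) (auto intro: subring_setD[OF assms(1)])

lemma subring_set_power: "subring_set V \<Longrightarrow> x \<in> V \<Longrightarrow> x ^ n \<in> V"
  by (induction n) (auto intro: subring_setD)

lemma subring_set_poly_coeffs:
  assumes V: "subring_set V"
  shows "subring_set {p. \<forall>i. coeff p i \<in> V}"
  unfolding subring_set_def
  by (auto simp: coeff_mult coeff_1 intro!: subring_set_sum[OF V] subring_setD[OF V])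

text \<open>Gaussian elimination replaces determinants. The pivot \<open>1 - w * r k k\<close> is
  invertible, and substituting the solved variable into the other equations only produces terms that
  again carry the factor \<open>w\<close>, so the smaller system has the same shape.\<close>

lemma nakayama_elimination:
  fixes w :: "'k::field" and b :: "'i \<Rightarrow> 'k"
  assumes R: "subring_set R" "w \<in> R" and u: "\<And>r. r \<in> R \<Longrightarrow> 1 - w * r \<noteq> 0 \<and> inverse (1 - w * r) \<in> R"
    and "finite I" and "\<And>i j. i \<in> I \<Longrightarrow> j \<in> I \<Longrightarrow> r i j \<in> R"
    and "\<And>i. i \<in> I \<Longrightarrow> b i = w * (\<Sum>j\<in>I. r i j * b j)"
  shows "\<forall>i\<in>I. b i = 0"
  using assms(4-6)
proof (induction I arbitrary: r rule: finite_induct)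
  case (insert k I)
  note D = subring_setD[OF R(1)]
  define t where "t = inverse (1 - w * r k k)"
  have t: "t \<in> R" "t * (1 - w * r k k) = 1" using u[of "r k k"] insert.prems(1) by (auto simp: t_def)
  have "(1 - w * r k k) * b k = w * (\<Sum>j\<in>I. r k j * b j)"
    using insert.prems(2)[of k] insert.hyps by (simp add: algebra_simps)
  hence "t * (1 - w * r k k) * b k = t * (w * (\<Sum>j\<in>I. r k j * b j))" by (simp add: mult.assoc)
  hence bk: "b k = w * (\<Sum>j\<in>I. t * r k j * b j)"
    using t(2) by (simp add: sum_distrib_left mult_ac)
  have "\<forall>i\<in>I. b i = 0"
  proof (rule insert.IH[where r = "\<lambda>i j. r i j + r i k * (w * (t * r k j))"])
    fix i j assume "i \<in> I" "j \<in> I"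
    thus "r i j + r i k * (w * (t * r k j)) \<in> R" using insert.prems(1) R(2) t by (auto intro!: D)
  next
    fix i assume "i \<in> I"
    hence "b i = w * (r i k * b k + (\<Sum>j\<in>I. r i j * b j))"
      using insert.prems(2)[of i] insert.hyps by simp
    also have "r i k * b k = (\<Sum>j\<in>I. r i k * (w * (t * r k j)) * b j)"
      by (subst bk) (simp add: sum_distrib_left mult_ac)
    finally show "b i = w * (\<Sum>j\<in>I. (r i j + r i k * (w * (t * r k j))) * b j)"
      by (simp add: sum.distrib distrib_right add.commute)
  qed
  thus ?case using bk by simp
qed simp

text \<open>Multiplying the relation by a power of \<open>z\<close> reverses the coefficients, and
  the constant term 1 becomes the leading coefficient of a monic equation for
  \<open>z\<close>.\<close>

lemma int_closure_if_inverse_root: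
  fixes z :: "'k::field"
  assumes "1 \<in> V" "0 \<in> V" "z \<noteq> 0" "\<And>i. coeff q i \<in> V" "1 + inverse z * poly q (inverse z) = 0"
  shows "z \<in> int_closure V"
proof -
  let ?p = "reflect_poly (pCons 1 q)"
  have "poly ?p z = 0" using assms(3,5) by (simp add: poly_reflect_poly_nz)
  moreover have "lead_coeff ?p = 1" by (simp add: degree_reflect_poly_eq coeff_reflect_poly)
  moreover have "coeff ?p i \<in> V" for i
    using assms(1,2,4) by (auto simp: coeff_reflect_poly coeff_pCons split: nat.split)
  ultimately show ?thesis unfolding int_closure_def by blast
qed

section \<open>Integrality through stable finitely generated modules\<close>

definition span_over :: "'k::field set \<Rightarrow> 'i set \<Rightarrow> ('i \<Rightarrow> 'k) \<Rightarrow> 'k set" where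
  "span_over V I b = {\<Sum>i\<in>I. c i * b i | c. \<forall>i\<in>I. c i \<in> V}"

text \<open>If z were not integral, \<open>w = z\<^sup>-\<^sup>1\<close> would lie in the Jacobson radical of the localization of
  \<open>V[w]\<close> at \<open>1 + w V[w]\<close>, and Nakayama's lemma would kill the span.\<close>
lemma int_closure_if_span_stable:
  fixes b :: "'i \<Rightarrow> 'k::field"
  assumes V: "subring_set V" and I: "finite I" "i0 \<in> I" "b i0 \<noteq> 0"
    and z: "\<And>i. i \<in> I \<Longrightarrow> z * b i \<in> span_over V I b"
  shows "z \<in> int_closure V"
proof (rule ccontr)
  assume nz: "z \<notin> int_closure V"
  have z0: "z \<noteq> 0"
  proof
    assume "z = 0"
    hence "z \<in> int_closure V" using subring_setD[OF V] unfolding int_closure_def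
      by (intro CollectI exI[of _ "[:0, 1:]"]) (auto simp: coeff_pCons split: nat.split)
    thus False using nz by simp
  qed
  define w where "w = inverse z"
  define P where "P = {poly p w | p. \<forall>i. coeff p i \<in> V}"
  have V': "subring_set {p. \<forall>i. coeff p i \<in> V}" using subring_set_poly_coeffs[OF V] .
  have P: "subring_set P"
    unfolding subring_set_def
  proof (intro conjI ballI)
    show "0 \<in> P" unfolding P_def using subring_setD(1)[OF V'] by (intro CollectI exI[of _ 0]) auto
    show "1 \<in> P" unfolding P_def using subring_setD(2)[OF V'] by (intro CollectI exI[of _ 1]) auto
    fix x y assume "x \<in> P" "y \<in> P"
    then obtain p q where "x = poly p w" "y = poly q w" "\<forall>i. coeff p i \<in> V" "\<forall>i. coeff q i \<in> V"
      unfolding P_def by blast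
    thus "x + y \<in> P" "x * y \<in> P"
      unfolding P_def using subring_setD(3)[OF V', of p q] subring_setD(4)[OF V', of p q]
      by (auto intro: exI[of _ "p + q"] exI[of _ "p * q"])
  next
    fix x assume "x \<in> P"
    thus "- x \<in> P" unfolding P_def using subring_setD(5)[OF V]
      by clarsimp (metis coeff_minus poly_minus)
  qed
  note PD = subring_setD[OF P]
  have VP: "v \<in> P" if "v \<in> V" for v
    unfolding P_def using that subring_setD(1)[OF V]
    by (intro CollectI exI[of _ "[:v:]"]) (auto simp: coeff_pCons split: nat.split)
  have wP: "w \<in> P"
    unfolding P_def using subring_setD[OF V]
    by (intro CollectI exI[of _ "[:0, 1:]"]) (auto simp: coeff_pCons split: nat.split)
  \<comment> \<open>A zero here would be an integral equation for \<open>z\<close> read backwards;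
    this is where non-integrality of \<open>z\<close> enters and what makes the denominators of
    \<open>R\<close> legitimate.\<close>
  have nonz: "1 + w * a \<noteq> 0" if "a \<in> P" for a
    using that int_closure_if_inverse_root[of V z] nz z0 subring_setD[OF V] unfolding P_def w_def by blast
  define R where "R = {a / (1 + w * b) | a b. a \<in> P \<and> b \<in> P}"
  have PR: "a \<in> R" if "a \<in> P" for a
    unfolding R_def using that PD(1) by (intro CollectI exI[of _ a] exI[of _ 0]) auto
  have R: "subring_set R"
    unfolding subring_set_def
  proof (intro conjI ballI)
    show "0 \<in> R" "1 \<in> R" using PR PD by auto
    fix x y assume "x \<in> R" "y \<in> R"
    then obtain a b c d where x: "x = a / (1 + w * b)" "a \<in> P" "b \<in> P" and y: "y = c / (1 + w * d)" "c \<in> P" "d \<in> P"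
      unfolding R_def by blast
    let ?d = "b + d + w * (b * d)"
    have d: "?d \<in> P" using x y wP by (auto intro!: PD)
    have e: "(1 + w * b) * (1 + w * d) = 1 + w * ?d" by (simp add: algebra_simps)
    have "x + y = (a * (1 + w * d) + c * (1 + w * b)) / (1 + w * ?d)"
      using x y nonz by (simp add: add_frac_eq flip: e)
    moreover have "a * (1 + w * d) + c * (1 + w * b) \<in> P" using x y wP by (auto intro!: PD)
    ultimately show "x + y \<in> R" using d unfolding R_def by blast
    have "x * y = (a * c) / (1 + w * ?d)" using x y by (simp flip: e)
    moreover have "a * c \<in> P" using x y by (auto intro!: PD)
    ultimately show "x * y \<in> R" using d unfolding R_def by blast
  next
    fix x assume "x \<in> R"
    then obtain a b where x: "x = a / (1 + w * b)" "a \<in> P" "b \<in> P" unfolding R_def by blast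
    hence "- x = (- a) / (1 + w * b)" "- a \<in> P" by (auto intro: PD)
    thus "- x \<in> R" using x(3) unfolding R_def by blast
  qed
  \<comment> \<open>This places \<open>w\<close> in the Jacobson radical of \<open>R\<close>:
    \<open>1 - w * r\<close> is a quotient of two elements of the form 1 plus a multiple of
    \<open>w\<close>, and so is its inverse.\<close>
  have u: "1 - w * r \<noteq> 0 \<and> inverse (1 - w * r) \<in> R" if "r \<in> R" for r
  proof -
    obtain a b where r: "r = a / (1 + w * b)" "a \<in> P" "b \<in> P" using \<open>r \<in> R\<close> unfolding R_def by blast
    have c: "b + - a \<in> P" by (intro PD(3,5) r)
    have e: "1 - w * r = (1 + w * (b + - a)) / (1 + w * b)"
      unfolding r(1) using nonz[OF r(3)] by (simp add: field_simps)
    have "inverse (1 - w * r) = (1 + w * b) / (1 + w * (b + - a))" unfolding e by simp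
    moreover have "1 + w * b \<in> P" using r wP by (auto intro!: PD)
    ultimately have "inverse (1 - w * r) \<in> R" using c unfolding R_def by blast
    moreover have "1 - w * r \<noteq> 0" unfolding e using nonz[OF c] nonz[OF r(3)] by simp
    ultimately show ?thesis by blast
  qed
  have "\<forall>i\<in>I. \<exists>c. (\<forall>j\<in>I. c j \<in> V) \<and> z * b i = (\<Sum>j\<in>I. c j * b j)"
    using z unfolding span_over_def by blast
  then obtain c where c: "\<And>i j. i \<in> I \<Longrightarrow> j \<in> I \<Longrightarrow> c i j \<in> V"
      "\<And>i. i \<in> I \<Longrightarrow> z * b i = (\<Sum>j\<in>I. c i j * b j)"
    by metis
  have "\<forall>i\<in>I. b i = 0"
  proof (rule nakayama_elimination[where r = c, OF R PR[OF wP] u I(1)])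
    show "c i j \<in> R" if "i \<in> I" "j \<in> I" for i j using c(1) that VP PR by blast
    show "b i = w * (\<Sum>j\<in>I. c i j * b j)" if "i \<in> I" for i
      unfolding c(2)[OF that, symmetric] using z0 by (simp add: w_def)
  qed
  thus False using I by blast
qed

lemma span_over_add:
  assumes V: "subring_set V" and "x \<in> span_over V I b" "y \<in> span_over V I b"
  shows "x + y \<in> span_over V I b"
proof -
  from assms obtain c d where "\<forall>i\<in>I. c i \<in> V" "x = (\<Sum>i\<in>I. c i * b i)" "\<forall>i\<in>I. d i \<in> V" "y = (\<Sum>i\<in>I. d i * b i)"
    unfolding span_over_def by blast
  thus ?thesis unfolding span_over_def
    by (intro CollectI exI[of _ "\<lambda>i. c i + d i"]) (auto simp: sum.distrib algebra_simps intro: subring_setD[OF V])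
qed

lemma span_over_scale:
  assumes V: "subring_set V" and "x \<in> span_over V I b" "a \<in> V"
  shows "a * x \<in> span_over V I b"
proof -
  from assms obtain c where "\<forall>i\<in>I. c i \<in> V" "x = (\<Sum>i\<in>I. c i * b i)"
    unfolding span_over_def by blast
  thus ?thesis unfolding span_over_def using assms(3)
    by (intro CollectI exI[of _ "\<lambda>i. a * c i"]) (auto simp: sum_distrib_left algebra_simps intro: subring_setD[OF V])
qed

lemma span_over_0: "subring_set V \<Longrightarrow> 0 \<in> span_over V I b"
  unfolding span_over_def by (intro CollectI exI[of _ "\<lambda>i. 0"]) (auto intro: subring_setD)

lemma span_over_base:
  assumes V: "subring_set V" and "finite I" "i \<in> I"
  shows "b i \<in> span_over V I b"
  unfolding span_over_def using assms
  by (intro CollectI exI[of _ "\<lambda>j. if j = i then 1 else 0"]) (auto simp: if_distrib[of "\<lambda>x. x * _"] cong: if_cong intro: subring_setD)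

lemma span_over_sum:
  assumes V: "subring_set V" and "\<And>j. j \<in> J \<Longrightarrow> h j \<in> span_over V I b"
  shows "sum h J \<in> span_over V I b"
  using assms(2) by (induction J rule: infinite_finite_induct) (auto intro: span_over_add[OF V] span_over_0[OF V])

lemma span_over_stable:
  assumes V: "subring_set V" and z: "\<And>i. i \<in> I \<Longrightarrow> z * b i \<in> span_over V I b" and w: "w \<in> span_over V I b"
  shows "z * w \<in> span_over V I b"
proof -
  from w obtain c where c: "\<forall>i\<in>I. c i \<in> V" "w = (\<Sum>i\<in>I. c i * b i)"
    unfolding span_over_def by blast
  have "z * w = (\<Sum>i\<in>I. c i * (z * b i))" using c by (simp add: sum_distrib_left algebra_simps)
  also have "\<dots> \<in> span_over V I b" using c by (intro span_over_sum[OF V] span_over_scale[OF V] z) auto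
  finally show ?thesis .
qed

text \<open>Solving a monic equation for its top power is the reduction used for sums and products.
  A constant monic polynomial has no root, and the resulting positive degree puts the monomial 1
  among the spanning monomials.\<close>

lemma power_degree_reduce:
  fixes x :: "'k::field"
  assumes "lead_coeff p = 1" "poly p x = 0"
  shows "x ^ degree p = (\<Sum>i<degree p. - coeff p i * x ^ i)" "degree p > 0"
proof -
  have "0 = (\<Sum>i\<le>degree p. coeff p i * x ^ i)" using assms by (simp add: poly_altdef)
  also have "\<dots> = (\<Sum>i<degree p. coeff p i * x ^ i) + x ^ degree p"
    using assms by (simp flip: lessThan_Suc_atMost)
  finally show "x ^ degree p = (\<Sum>i<degree p. - coeff p i * x ^ i)"
    by (simp add: sum_negf eq_neg_iff_add_eq_0 add.commute)
  show "degree p > 0"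
  proof (rule ccontr)
    assume "\<not> degree p > 0"
    then obtain a where "p = [:a:]" using degree_eq_zeroE by auto
    thus False using assms by (auto split: if_splits)
  qed
qed

text \<open>The monomials \<open>x ^ i * y ^ j\<close> with exponents below the degrees of two monic
  equations span a V-module that is stable under \<open>x\<close> and \<open>y\<close>, because the
  equations rewrite the top powers. It contains 1, so the span criterion settles sum, product and
  negative with the same module.\<close>

lemma int_closure_closed:
  fixes x y :: "'k::field"
  assumes V: "subring_set V" and x: "x \<in> int_closure V" and y: "y \<in> int_closure V"
  shows "x + y \<in> int_closure V" "x * y \<in> int_closure V" "- x \<in> int_closure V"
proof -
  obtain p where p: "lead_coeff p = 1" "\<And>i. coeff p i \<in> V" "poly p x = 0"
    using x unfolding int_closure_def by blast
  obtain q where q: "lead_coeff q = 1" "\<And>i. coeff q i \<in> V" "poly q y = 0"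
    using y unfolding int_closure_def by blast
  note px = power_degree_reduce[OF p(1,3)] and qy = power_degree_reduce[OF q(1,3)]
  define I where "I = {..<degree p} \<times> {..<degree q}"
  define b where "b = (\<lambda>(i, j). x ^ i * y ^ j)"
  let ?W = "span_over V I b"
  have I: "finite I" "(0, 0) \<in> I" "b (0, 0) \<noteq> 0" using px qy by (auto simp: I_def b_def)
  have bW: "b k \<in> ?W" if "k \<in> I" for k using span_over_base[OF V I(1) that] .
  have xW: "x * b k \<in> ?W" if k: "k \<in> I" for k
  proof -
    obtain i j where ij: "k = (i, j)" "i < degree p" "j < degree q" using k by (auto simp: I_def)
    show ?thesis
    proof (cases "Suc i < degree p")
      case True
      have "x * b k = b (Suc i, j)" by (simp add: b_def ij)
      thus ?thesis using bW True ij by (simp add: I_def)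
    next
      case False
      hence "Suc i = degree p" using ij by simp
      hence "x * b k = x ^ degree p * y ^ j" by (simp add: b_def ij flip: power_Suc mult.assoc)
      also have "\<dots> = (\<Sum>l<degree p. - coeff p l * b (l, j))"
        unfolding px(1) by (simp only: sum_distrib_right b_def mult.assoc prod.case)
      also have "\<dots> \<in> ?W" using p(2) ij
        by (intro span_over_sum[OF V] span_over_scale[OF V] bW subring_setD(5)[OF V]) (auto simp: I_def)
      finally show ?thesis .
    qed
  qed
  have yW: "y * b k \<in> ?W" if k: "k \<in> I" for k
  proof -
    obtain i j where ij: "k = (i, j)" "i < degree p" "j < degree q" using k by (auto simp: I_def)
    show ?thesis
    proof (cases "Suc j < degree q")
      case True
      have "y * b k = b (i, Suc j)" by (simp add: b_def ij)
      thus ?thesis using bW True ij by (simp add: I_def)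
    next
      case False
      hence "Suc j = degree q" using ij by simp
      hence "y ^ degree q = y * y ^ j" by (metis power_Suc)
      hence "y * b k = x ^ i * y ^ degree q" by (simp add: b_def ij)
      also have "\<dots> = (\<Sum>l<degree q. - coeff q l * b (i, l))"
        unfolding qy(1) by (simp only: sum_distrib_left b_def mult.left_commute prod.case)
      also have "\<dots> \<in> ?W" using q(2) ij
        by (intro span_over_sum[OF V] span_over_scale[OF V] bW subring_setD(5)[OF V]) (auto simp: I_def)
      finally show ?thesis .
    qed
  qed
  show "x + y \<in> int_closure V"
    by (rule int_closure_if_span_stable[where b = b, OF V I]) (auto simp: distrib_right intro: span_over_add[OF V] xW yW)
  show "x * y \<in> int_closure V"
    by (rule int_closure_if_span_stable[where b = b, OF V I]) (auto simp: mult.assoc intro: span_over_stable[OF V xW] yW)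
  show "- x \<in> int_closure V"
  proof (rule int_closure_if_span_stable[where b = b, OF V I])
    fix i assume "i \<in> I"
    thus "- x * b i \<in> ?W" using span_over_scale[OF V xW, of i "-1"] by (auto intro: subring_setD[OF V])
  qed
qed

lemma subset_int_closure:
  assumes "subring_set V"
  shows "V \<subseteq> int_closure V"
proof
  fix x assume "x \<in> V"
  thus "x \<in> int_closure V" unfolding int_closure_def
    using subring_setD[OF assms]
    by (intro CollectI exI[of _ "[:-x, 1:]"]) (auto simp: coeff_pCons split: nat.split)
qed

lemma subring_set_int_closure:
  assumes "subring_set V"
  shows "subring_set (int_closure V)"
  using int_closure_closed[OF assms] subset_int_closure[OF assms] subring_setD[OF assms]
  unfolding subring_set_def by blast

section \<open>Galois action on the maximal ideals\<close>

locale galois_valuation =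
  fixes G :: "('k::field \<Rightarrow> 'k) set" and V :: "'k set"
  assumes G: "aut_group G"
    and V: "valuation_domain_of (fixfield G) V"
begin

abbreviation S :: "'k set" where "S \<equiv> int_closure V"

section \<open>Arithmetic of the automorphism group\<close>

lemma finite_G: "finite G" and id_G: "id \<in> G"
  using G by (auto simp: aut_group_def)

lemma comp_G: "\<sigma> \<in> G \<Longrightarrow> \<tau> \<in> G \<Longrightarrow> \<sigma> \<circ> \<tau> \<in> G"
  and inv_G: "\<sigma> \<in> G \<Longrightarrow> inv \<sigma> \<in> G"
  and bij_G: "\<sigma> \<in> G \<Longrightarrow> bij \<sigma>"
  using G by (auto simp: aut_group_def)

lemma aut_add: "\<sigma> \<in> G \<Longrightarrow> \<sigma> (x + y) = \<sigma> x + \<sigma> y"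
  and aut_mult: "\<sigma> \<in> G \<Longrightarrow> \<sigma> (x * y) = \<sigma> x * \<sigma> y"
  and aut_1: "\<sigma> \<in> G \<Longrightarrow> \<sigma> 1 = 1"
  using G by (auto simp: aut_group_def)

lemma aut_0: "\<sigma> \<in> G \<Longrightarrow> \<sigma> 0 = 0"
  by (metis aut_add add.right_neutral add_cancel_left_right)

lemma aut_eq_0_iff: "\<sigma> \<in> G \<Longrightarrow> \<sigma> x = 0 \<longleftrightarrow> x = 0"
  using bij_is_inj[OF bij_G] aut_0 by (metis injD)

lemma aut_divide: "\<sigma> \<in> G \<Longrightarrow> \<sigma> (x / y) = \<sigma> x / \<sigma> y"
  by (cases "y = 0") (auto simp: aut_0 eq_divide_eq aut_eq_0_iff simp flip: aut_mult)

lemma aut_inverse: "\<sigma> \<in> G \<Longrightarrow> \<sigma> (inverse x) = inverse (\<sigma> x)"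
  using aut_divide[of \<sigma> 1 x] aut_1 by (simp add: divide_inverse)

lemma aut_sum: "\<sigma> \<in> G \<Longrightarrow> \<sigma> (sum g I) = (\<Sum>i\<in>I. \<sigma> (g i))"
  by (induction I rule: infinite_finite_induct) (auto simp: aut_0 aut_add)

lemma aut_prod: "\<sigma> \<in> G \<Longrightarrow> \<sigma> (prod g I) = (\<Prod>i\<in>I. \<sigma> (g i))"
  by (induction I rule: infinite_finite_induct) (auto simp: aut_1 aut_mult)

lemma aut_power: "\<sigma> \<in> G \<Longrightarrow> \<sigma> (x ^ n) = \<sigma> x ^ n"
  by (induction n) (auto simp: aut_1 aut_mult)

lemma inv_inv_G: "\<sigma> \<in> G \<Longrightarrow> inv (inv \<sigma>) = \<sigma>"
  using bij_G inv_inv_eq by blast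

lemma inv_comp_G: "\<sigma> \<in> G \<Longrightarrow> \<tau> \<in> G \<Longrightarrow> inv (\<sigma> \<circ> \<tau>) = inv \<tau> \<circ> inv \<sigma>"
  using bij_G o_inv_distrib by blast

lemma app_inv: "\<sigma> \<in> G \<Longrightarrow> \<sigma> (inv \<sigma> x) = x" and inv_app: "\<sigma> \<in> G \<Longrightarrow> inv \<sigma> (\<sigma> x) = x"
  using bij_G by (simp_all add: bij_is_surj surj_f_inv_f bij_is_inj)

lemma comp_inv: "\<sigma> \<in> G \<Longrightarrow> \<sigma> \<circ> inv \<sigma> = id" and inv_comp: "\<sigma> \<in> G \<Longrightarrow> inv \<sigma> \<circ> \<sigma> = id"
  by (auto simp: fun_eq_iff app_inv inv_app)

lemma comp_inv_cancel: "\<sigma> \<in> G \<Longrightarrow> \<sigma> \<circ> (inv \<sigma> \<circ> \<tau>) = \<tau>"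
  and inv_comp_cancel: "\<sigma> \<in> G \<Longrightarrow> inv \<sigma> \<circ> (\<sigma> \<circ> \<tau>) = \<tau>"
  by (auto simp: fun_eq_iff app_inv inv_app)

lemmas G_closed = id_G comp_G inv_G
lemmas G_simps = inv_inv_G inv_comp_G comp_inv inv_comp comp_inv_cancel inv_comp_cancel comp_assoc inv_id

lemma image_iff_inv: "\<sigma> \<in> G \<Longrightarrow> x \<in> \<sigma> ` A \<longleftrightarrow> inv \<sigma> x \<in> A"
  using app_inv[of \<sigma>] inv_app[of \<sigma>] by (auto simp: image_iff) metis

lemma image_image_inv: "\<sigma> \<in> G \<Longrightarrow> \<sigma> ` inv \<sigma> ` A = A" "\<sigma> \<in> G \<Longrightarrow> inv \<sigma> ` \<sigma> ` A = A"
  by (simp_all add: image_comp comp_inv inv_comp)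

lemma subring_V: "subring_set V"
  using V by (auto simp: valuation_domain_of_def subring_set_def)

lemma V_fixed: "x \<in> V \<Longrightarrow> \<sigma> \<in> G \<Longrightarrow> \<sigma> x = x"
  using V by (auto simp: valuation_domain_of_def fixfield_def)

lemma subring_S: "subring_set S"
  using subring_V by (rule subring_set_int_closure)

lemma V_subset_S: "V \<subseteq> S"
  using subring_V by (rule subset_int_closure)

lemmas SD = subring_setD[OF subring_S] and VD = subring_setD[OF subring_V]

text \<open>The coefficients of an integral equation over V are fixed by G, so the same monic
  polynomial vanishes at every conjugate.\<close>

lemma aut_S: "\<sigma> \<in> G \<Longrightarrow> x \<in> S \<Longrightarrow> \<sigma> x \<in> S"
proof -
  assume s: "\<sigma> \<in> G" and "x \<in> S"
  then obtain p where p: "lead_coeff p = 1" "\<forall>i. coeff p i \<in> V" "poly p x = 0"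
    unfolding int_closure_def by blast
  have "poly p (\<sigma> x) = \<sigma> (poly p x)"
    using p(2) s by (simp add: poly_altdef aut_sum aut_mult aut_power V_fixed)
  thus ?thesis using p s unfolding int_closure_def by (auto simp: aut_0)
qed

lemma image_S: "\<sigma> \<in> G \<Longrightarrow> \<sigma> ` S = S"
  using aut_S inv_G by (auto simp: image_iff_inv)

section \<open>Maximal ideals of S and their images under G\<close>

lemma max_idealD:
  assumes "max_ideal_of S M"
  shows "M \<subseteq> S" "0 \<in> M" "x \<in> M \<Longrightarrow> y \<in> M \<Longrightarrow> x + y \<in> M" "r \<in> S \<Longrightarrow> x \<in> M \<Longrightarrow> r * x \<in> M"
    "r \<in> S \<Longrightarrow> x \<in> M \<Longrightarrow> x * r \<in> M" "1 \<notin> M"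
proof -
  show A: "M \<subseteq> S" "0 \<in> M" "\<And>x y. x \<in> M \<Longrightarrow> y \<in> M \<Longrightarrow> x + y \<in> M" "\<And>x r. r \<in> S \<Longrightarrow> x \<in> M \<Longrightarrow> r * x \<in> M"
    using assms by (auto simp: max_ideal_of_def ideal_of_def)
  show "r \<in> S \<Longrightarrow> x \<in> M \<Longrightarrow> x * r \<in> M" using A(4) by (simp add: mult.commute)
  show "1 \<notin> M"
  proof
    assume "1 \<in> M"
    hence "S \<subseteq> M" using A(4)[of _ 1] by auto
    thus False using assms A(1) by (auto simp: max_ideal_of_def)
  qed
qed

lemma max_ideal_sum:
  assumes "max_ideal_of S M" "\<And>i. i \<in> I \<Longrightarrow> g i \<in> M"
  shows "sum g I \<in> M"
  using assms(2) by (induction I rule: infinite_finite_induct) (auto intro: max_idealD[OF assms(1)])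

lemma max_ideal_comaximal:
  assumes M: "max_ideal_of S M" and I: "ideal_of S I" "\<not> I \<subseteq> M"
  obtains s m where "s \<in> I" "m \<in> M" "1 = s + m"
proof -
  define J where "J = {s + m | s m. s \<in> I \<and> m \<in> M}"
  note MD = max_idealD[OF M]
  have ID: "I \<subseteq> S" "0 \<in> I" "\<And>x y. x \<in> I \<Longrightarrow> y \<in> I \<Longrightarrow> x + y \<in> I" "\<And>r x. r \<in> S \<Longrightarrow> x \<in> I \<Longrightarrow> r * x \<in> I"
    using I(1) by (auto simp: ideal_of_def)
  have "ideal_of S J" unfolding ideal_of_def
  proof (intro conjI ballI)
    show "J \<subseteq> S" using ID(1) MD(1) SD(3) by (auto simp: J_def)
    show "0 \<in> J" unfolding J_def using ID(2) MD(2) by force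
    fix x y assume "x \<in> J" "y \<in> J"
    then obtain s m s' m' where "x = s + m" "y = s' + m'" "s \<in> I" "s' \<in> I" "m \<in> M" "m' \<in> M" unfolding J_def by blast
    hence "x + y = (s + s') + (m + m')" "s + s' \<in> I" "m + m' \<in> M" by (auto intro: ID MD)
    thus "x + y \<in> J" unfolding J_def by blast
  next
    fix r x assume "r \<in> S" "x \<in> J"
    then obtain s m where "x = s + m" "s \<in> I" "m \<in> M" unfolding J_def by blast
    hence "r * x = r * s + r * m" "r * s \<in> I" "r * m \<in> M" using \<open>r \<in> S\<close> by (auto intro: ID MD simp: distrib_left)
    thus "r * x \<in> J" unfolding J_def by blast
  qed
  moreover have MJ: "M \<subseteq> J" using ID(2) by (force simp: J_def)
  moreover have IJ: "I \<subseteq> J" using MD(2) by (force simp: J_def)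
  ultimately have "J = S" using M I(2) unfolding max_ideal_of_def by metis
  hence "1 \<in> J" using SD(2) by simp
  thus ?thesis using that unfolding J_def by blast
qed

lemma ideal_of_principal: "x \<in> S \<Longrightarrow> ideal_of S {s * x | s. s \<in> S}"
proof -
  assume x: "x \<in> S"
  show ?thesis unfolding ideal_of_def
  proof (intro conjI ballI)
    show "{s * x | s. s \<in> S} \<subseteq> S" using x by (auto intro: SD)
    show "0 \<in> {s * x | s. s \<in> S}" using SD(1) by force
    fix a b assume "a \<in> {s * x | s. s \<in> S}" "b \<in> {s * x | s. s \<in> S}"
    then obtain s t where "a = s * x" "b = t * x" "s \<in> S" "t \<in> S" by blast
    thus "a + b \<in> {s * x | s. s \<in> S}" by (auto intro!: exI[of _ "s + t"] SD simp: distrib_right)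
  next
    fix r a assume "r \<in> S" "a \<in> {s * x | s. s \<in> S}"
    then obtain s where "a = s * x" "s \<in> S" by blast
    thus "r * a \<in> {s * x | s. s \<in> S}" using \<open>r \<in> S\<close> by (auto intro!: exI[of _ "r * s"] SD)
  qed
qed

text \<open>The residue ring of a maximal ideal is a field, and \<open>s\<close> represents the
  inverse of \<open>x\<close> in it.\<close>

lemma max_ideal_inverse_mod:
  assumes M: "max_ideal_of S M" and x: "x \<in> S" "x \<notin> M"
  obtains s m where "s \<in> S" "m \<in> M" "1 = s * x + m"
proof (rule max_ideal_comaximal[OF M ideal_of_principal[OF x(1)]])
  have "1 * x \<in> {s * x | s. s \<in> S}" using SD(2) by blast
  thus "\<not> {s * x | s. s \<in> S} \<subseteq> M" using x by auto
next
  fix s m assume "s \<in> {s * x | s. s \<in> S}" "m \<in> M" "1 = s + m"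
  thus thesis using that by blast
qed

lemma max_ideal_prime:
  assumes M: "max_ideal_of S M" and "x \<in> S" "y \<in> S"
  shows "x * y \<in> M \<longleftrightarrow> x \<in> M \<or> y \<in> M"
proof
  assume xy: "x * y \<in> M"
  show "x \<in> M \<or> y \<in> M"
  proof (rule ccontr)
    assume nt: "\<not> ?thesis"
    then obtain s m where sm: "s \<in> S" "m \<in> M" "1 = s * x + m" using max_ideal_inverse_mod[OF M assms(2)] by blast
    have "y = (s * x + m) * y" using sm(3) by simp
    also have "\<dots> = s * (x * y) + m * y" by (simp add: algebra_simps)
    also have "\<dots> \<in> M" by (rule max_idealD(3)[OF M max_idealD(4)[OF M sm(1) xy] max_idealD(5)[OF M assms(3) sm(2)]])
    finally show False using nt by simp
  qed
qed (use max_idealD(4)[OF M assms(2)] max_idealD(5)[OF M assms(3)] in blast)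

lemma max_ideal_prod:
  assumes M: "max_ideal_of S M" and "finite I" "\<And>i. i \<in> I \<Longrightarrow> g i \<in> S"
  shows "prod g I \<in> M \<longleftrightarrow> (\<exists>i\<in>I. g i \<in> M)"
  using assms(2,3)
proof (induction I rule: finite_induct)
  case (insert i I)
  have "prod g I \<in> S" using insert.prems by (intro subring_set_prod[OF subring_S]) auto
  thus ?case using insert by (simp add: max_ideal_prime[OF M])
qed (use max_idealD[OF M] in simp)

lemma ideal_image:
  assumes s: "\<sigma> \<in> G" and I: "ideal_of S I"
  shows "ideal_of S (\<sigma> ` I)"
  unfolding ideal_of_def
proof (intro conjI ballI)
  have ID: "I \<subseteq> S" "0 \<in> I" "\<And>x y. x \<in> I \<Longrightarrow> y \<in> I \<Longrightarrow> x + y \<in> I" "\<And>r x. r \<in> S \<Longrightarrow> x \<in> I \<Longrightarrow> r * x \<in> I"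
    using I by (auto simp: ideal_of_def)
  show "\<sigma> ` I \<subseteq> S" using ID(1) aut_S[OF s] by blast
  show "0 \<in> \<sigma> ` I" using ID(2) aut_0[OF s] by (metis imageI)
  fix x y assume "x \<in> \<sigma> ` I" "y \<in> \<sigma> ` I"
  thus "x + y \<in> \<sigma> ` I" using ID(3) aut_add[OF s] by (metis (no_types, lifting) imageE imageI)
next
  have ID: "\<And>r x. r \<in> S \<Longrightarrow> x \<in> I \<Longrightarrow> r * x \<in> I" using I by (auto simp: ideal_of_def)
  fix r x assume r: "r \<in> S" "x \<in> \<sigma> ` I"
  hence "inv \<sigma> r * inv \<sigma> x \<in> I" using ID aut_S[OF inv_G[OF s]] by (simp add: image_iff_inv[OF s])
  thus "r * x \<in> \<sigma> ` I" by (simp add: image_iff_inv[OF s] aut_mult[OF inv_G[OF s]])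
qed

lemma max_ideal_image:
  assumes s: "\<sigma> \<in> G" and M: "max_ideal_of S M"
  shows "max_ideal_of S (\<sigma> ` M)"
  unfolding max_ideal_of_def
proof (intro conjI allI impI)
  show "ideal_of S (\<sigma> ` M)" using M ideal_image[OF s] by (simp add: max_ideal_of_def)
  show "\<sigma> ` M \<noteq> S" using max_idealD(6)[OF M] SD(2) s inv_G[OF s] by (metis aut_1 image_iff_inv)
  fix I assume I: "ideal_of S I \<and> \<sigma> ` M \<subseteq> I"
  have "ideal_of S (inv \<sigma> ` I)" using I ideal_image[OF inv_G[OF s]] by simp
  moreover have "M \<subseteq> inv \<sigma> ` I" using I image_image_inv[OF s] by (metis image_mono)
  ultimately have "inv \<sigma> ` I = M \<or> inv \<sigma> ` I = S" using M by (simp add: max_ideal_of_def)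
  thus "I = \<sigma> ` M \<or> I = S" using image_image_inv[OF s] image_S[OF s] by metis
qed

section \<open>Contraction to V and transitivity of the action\<close>

lemma max_ideal_subset_eq:
  assumes "max_ideal_of S M" "max_ideal_of S M'" "M \<subseteq> M'"
  shows "M = M'"
  using assms unfolding max_ideal_of_def by metis

text \<open>A nonunit of V outside M would be invertible modulo M, and an integral equation for the
  inverse brings the contradiction down to V. This inclusion later carries a norm from one maximal
  ideal of S into another one.\<close>

lemma val_max_subset_max_ideal:
  assumes M: "max_ideal_of S M" and a: "a \<in> val_max V"
  shows "a \<in> M"
proof (rule ccontr)
  assume aM: "a \<notin> M"
  have aV: "a \<in> V" and na: "a \<notin> units_of_sub V" using a by (auto simp: val_max_def)
  have a0: "a \<noteq> 0" using aM max_idealD(2)[OF M] by auto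
  have "a \<in> S" using aV V_subset_S by auto
  then obtain b m where b: "b \<in> S" "m \<in> M" "1 = b * a + m" using aM max_ideal_inverse_mod[OF M] by blast
  obtain p where p: "lead_coeff p = 1" "\<And>i. coeff p i \<in> V" "poly p b = 0"
    using b(1) unfolding int_closure_def by blast
  define n where "n = degree p"
  \<comment> \<open>Multiplying the integral equation of b, the inverse of a modulo M, by a power of a
    yields an element of M that is congruent to 1 modulo a V, hence a unit of V.\<close>
  define v where "v = (\<Sum>i<n. coeff p i * a ^ (n - 1 - i))"
  have vV: "v \<in> V" unfolding v_def
    by (intro subring_set_sum[OF subring_V] VD(4) p(2) subring_set_power[OF subring_V] aV)
  have pow: "(b * a) ^ i - 1 \<in> M" for i
  proof (induction i)
    case (Suc i)
    have "(b * a) ^ Suc i - 1 = (b * a) * ((b * a) ^ i - 1) + (-1) * m" using b(3) by (simp add: algebra_simps)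
    also have "\<dots> \<in> M" using Suc b \<open>a \<in> S\<close> SD by (intro max_idealD[OF M]) auto
    finally show ?case .
  qed (simp add: max_idealD[OF M])
  have "0 = a ^ n * (\<Sum>i\<le>n. coeff p i * b ^ i)" using p(3) by (simp add: poly_altdef n_def)
  also have "\<dots> = (\<Sum>i\<le>n. coeff p i * a ^ (n - i) * (b * a) ^ i)"
    unfolding sum_distrib_left
    by (rule sum.cong) (auto simp: power_mult_distrib mult_ac simp flip: power_add)
  also have "\<dots> = (\<Sum>i\<le>n. coeff p i * a ^ (n - i)) + (\<Sum>i\<le>n. coeff p i * a ^ (n - i) * ((b * a) ^ i - 1))"
    by (simp add: algebra_simps flip: sum.distrib)
  finally have "(\<Sum>i\<le>n. coeff p i * a ^ (n - i)) = (-1) * (\<Sum>i\<le>n. coeff p i * a ^ (n - i) * ((b * a) ^ i - 1))"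
    by (simp add: eq_neg_iff_add_eq_0)
  also have "\<dots> \<in> M"
    using p(2) V_subset_S pow \<open>a \<in> S\<close> SD
    by (intro max_idealD(4)[OF M] max_ideal_sum[OF M] SD(4) subring_set_power[OF subring_S]) auto
  also have "(\<Sum>i\<le>n. coeff p i * a ^ (n - i)) = 1 + a * v"
  proof -
    have "(\<Sum>i\<le>n. coeff p i * a ^ (n - i)) = (\<Sum>i<n. coeff p i * a ^ (n - i)) + 1"
      using p(1) by (simp add: n_def flip: lessThan_Suc_atMost)
    also have "(\<Sum>i<n. coeff p i * a ^ (n - i)) = a * v"
      unfolding v_def sum_distrib_left
    proof (rule sum.cong[OF refl])
      fix i assume "i \<in> {..<n}"
      hence "n - i = Suc (n - 1 - i)" by auto
      thus "coeff p i * a ^ (n - i) = a * (coeff p i * a ^ (n - 1 - i))" by simp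
    qed
    finally show ?thesis by simp
  qed
  finally have uM: "1 + a * v \<in> M" .
  let ?u = "1 + a * v"
  have uV: "?u \<in> V" using aV vV VD by auto
  have noinv: "inverse y \<notin> V" if "y \<in> V" "y \<in> M" "y \<noteq> 0" for y
    using max_idealD(4)[OF M, of "inverse y" y] max_idealD(6)[OF M] that V_subset_S by auto
  have u0: "?u \<noteq> 0"
  proof
    assume "?u = 0"
    hence "a * (- v) = 1" by (simp add: add_eq_0_iff)
    hence "inverse a = - v" using a0 by (simp add: field_simps)
    thus False using na aV a0 vV VD(5) by (auto simp: units_of_sub_def)
  qed
  \<comment> \<open>Two elements of a valuation domain are comparable under division. If
    \<open>a\<close> divides \<open>?u\<close>, it divides 1, although it is no unit of V; if
    \<open>?u\<close> divides \<open>a\<close>, then \<open>?u\<close> divides 1, although it lies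
    in M.\<close>
  define q where "q = ?u / a"
  have "\<tau> q = q" if "\<tau> \<in> G" for \<tau>
    using V_fixed[OF uV that] V_fixed[OF aV that] by (simp add: q_def aut_divide[OF that])
  hence "q \<in> fixfield G" by (simp add: fixfield_def)
  moreover have "q \<noteq> 0" using u0 a0 by (simp add: q_def)
  ultimately have "q \<in> V \<or> inverse q \<in> V" using V by (auto simp: valuation_domain_of_def)
  thus False
  proof
    assume "q \<in> V"
    hence "q + - v \<in> V" using vV by (intro VD)
    moreover have "q + - v = inverse a" using a0 by (simp add: q_def field_simps)
    ultimately show False using na aV a0 by (auto simp: units_of_sub_def)
  next
    assume iq: "inverse q \<in> V"
    have "inverse ?u = 1 + - (inverse q * v)" using u0 a0 by (simp add: q_def field_simps)
    also have "\<dots> \<in> V" using iq vV by (intro VD)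
    finally show False using noinv[OF uV uM u0] by simp
  qed
qed

text \<open>A valuation domain is integrally closed: if \<open>x\<close> is not in V, its inverse
  is, and dividing the integral equation by the power one below the top writes \<open>x\<close> as a
  polynomial in that inverse.\<close>

lemma S_inter_fixfield:
  assumes "x \<in> S" "x \<in> fixfield G"
  shows "x \<in> V"
proof (rule ccontr)
  assume nx: "x \<notin> V"
  hence x0: "x \<noteq> 0" using VD(1) by auto
  hence iV: "inverse x \<in> V" using V assms(2) nx by (auto simp: valuation_domain_of_def)
  obtain p where p: "lead_coeff p = 1" "\<And>i. coeff p i \<in> V" "poly p x = 0"
    using assms(1) unfolding int_closure_def by blast
  define n where "n = degree p"
  have n: "n > 0" and e: "x ^ n = (\<Sum>i<n. - coeff p i * x ^ i)"
    using power_degree_reduce[OF p(1,3)] by (auto simp: n_def)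
  have "x = x ^ n * inverse x ^ (n - 1)"
    using n x0 by (cases n) (simp_all add: field_simps)
  also have "\<dots> = (\<Sum>i<n. - coeff p i * inverse x ^ (n - 1 - i))"
    unfolding e sum_distrib_right
  proof (rule sum.cong[OF refl])
    fix i assume "i \<in> {..<n}"
    hence "n - 1 = i + (n - 1 - i)" by auto
    hence "inverse x ^ (n - 1) = inverse x ^ i * inverse x ^ (n - 1 - i)" by (metis power_add)
    thus "- coeff p i * x ^ i * inverse x ^ (n - 1) = - coeff p i * inverse x ^ (n - 1 - i)"
      using x0 by (simp add: power_inverse)
  qed
  also have "\<dots> \<in> V"
    using p(2) iV by (intro subring_set_sum[OF subring_V] VD(4,5) subring_set_power[OF subring_V])
  finally show False using nx by simp
qed

text \<open>If M lay outside the orbit of N, then an element of M congruent to 1 modulo every conjugate of N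
  would have its norm in the maximal ideal of V, hence in N.\<close>
lemma max_ideal_transitive:
  assumes M: "max_ideal_of S M" and N: "max_ideal_of S N"
  obtains \<omega> where "\<omega> \<in> G" "M = \<omega> ` N"
proof (rule ccontr)
  assume "\<not> thesis"
  hence ne: "\<omega> ` N \<noteq> M" if "\<omega> \<in> G" for \<omega> using that \<open>\<And>\<omega>. \<omega> \<in> G \<Longrightarrow> M = \<omega> ` N \<Longrightarrow> thesis\<close> by blast
  have oN: "max_ideal_of S (\<omega> ` N)" if "\<omega> \<in> G" for \<omega> using max_ideal_image[OF that N] .
  have "\<exists>b. b \<in> \<omega> ` N \<and> 1 - b \<in> M" if w: "\<omega> \<in> G" for \<omega>
  proof -
    have "\<not> \<omega> ` N \<subseteq> M" using max_ideal_subset_eq[OF oN[OF w] M] ne[OF w] by blast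
    moreover have "ideal_of S (\<omega> ` N)" using oN[OF w] by (simp add: max_ideal_of_def)
    ultimately obtain s m where "s \<in> \<omega> ` N" "m \<in> M" "1 = s + m" using max_ideal_comaximal[OF M] by blast
    moreover from this have "m = 1 - s" by (simp add: eq_diff_eq add.commute)
    ultimately show ?thesis by blast
  qed
  then obtain b where b: "\<And>\<omega>. \<omega> \<in> G \<Longrightarrow> b \<omega> \<in> \<omega> ` N" "\<And>\<omega>. \<omega> \<in> G \<Longrightarrow> 1 - b \<omega> \<in> M" by metis
  have bS: "b \<omega> \<in> S" if "\<omega> \<in> G" for \<omega> using b(1) that max_idealD(1)[OF oN] by blast
  \<comment> \<open>The product lies in every conjugate of N and stays congruent to 1 modulo M, so
    its complement \<open>1 - c\<close> has the opposite behaviour.\<close>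
  define c where "c = (\<Prod>\<omega>\<in>G. b \<omega>)"
  have "1 - (\<Prod>\<omega>\<in>H. b \<omega>) \<in> M" if "finite H" "H \<subseteq> G" for H
    using that
  proof (induction H rule: finite_induct)
    case (insert \<omega> H)
    have "1 - (\<Prod>\<omega>\<in>insert \<omega> H. b \<omega>) = b \<omega> * (1 - (\<Prod>\<omega>\<in>H. b \<omega>)) + (1 - b \<omega>)"
      using insert.hyps by (simp add: algebra_simps)
    also have "\<dots> \<in> M" using insert b(2) bS by (intro max_idealD(3,4)[OF M]) auto
    finally show ?case .
  qed (simp add: max_idealD[OF M])
  hence xM: "1 - c \<in> M" using finite_G by (simp add: c_def)
  have cN: "c \<in> \<omega> ` N" if "\<omega> \<in> G" for \<omega>
    unfolding c_def using max_ideal_prod[OF oN[OF that] finite_G, of b] bS b(1) that by blast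
  have xN: "1 - c \<notin> \<omega> ` N" if "\<omega> \<in> G" for \<omega>
    using max_idealD(3,6)[OF oN[OF that]] cN[OF that] by (metis diff_add_cancel)
  define x where "x = 1 - c"
  have xS: "x \<in> S" using xM max_idealD(1)[OF M] by (auto simp: x_def)
  \<comment> \<open>The norm of \<open>x\<close> is integral and G-invariant, hence in V; the factor
    for \<open>id\<close> puts it in M, so it is not a unit of V.\<close>
  define y where "y = (\<Prod>\<omega>\<in>G. \<omega> x)"
  have yS: "y \<in> S" unfolding y_def using aut_S xS by (intro subring_set_prod[OF subring_S])
  have "\<sigma> y = y" if s: "\<sigma> \<in> G" for \<sigma>
  proof -
    have "\<sigma> y = (\<Prod>\<omega>\<in>G. (\<sigma> \<circ> \<omega>) x)" using s by (simp add: y_def aut_prod)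
    also have "\<dots> = y" unfolding y_def
      by (rule prod.reindex_bij_witness[of _ "\<lambda>\<omega>. inv \<sigma> \<circ> \<omega>" "\<lambda>\<omega>. \<sigma> \<circ> \<omega>"]) (use s in \<open>auto simp: G_simps intro: G_closed\<close>)
    finally show ?thesis .
  qed
  hence yV: "y \<in> V" using S_inter_fixfield yS by (simp add: fixfield_def)
  have yM: "y \<in> M" unfolding y_def using max_ideal_prod[OF M finite_G, of "\<lambda>\<omega>. \<omega> x"] aut_S xS xM id_G
    by (auto simp: x_def intro: bexI[of _ id])
  have "y \<in> val_max V"
  proof -
    have "inverse y \<notin> V" if "y \<noteq> 0"
      using max_idealD(4)[OF M, of "inverse y" y] max_idealD(6)[OF M] that yM V_subset_S by auto
    thus ?thesis using yV by (auto simp: val_max_def units_of_sub_def)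
  qed
  \<comment> \<open>N is prime, so it contains one of the conjugates of \<open>x\<close>; pulling
    that back places \<open>x\<close> in a conjugate of N, where it is congruent to 1.\<close>
  hence "y \<in> N" using val_max_subset_max_ideal[OF N] by simp
  then obtain \<omega> where w: "\<omega> \<in> G" "\<omega> x \<in> N"
    unfolding y_def using max_ideal_prod[OF N finite_G, of "\<lambda>\<omega>. \<omega> x"] aut_S xS by auto
  hence "x \<in> inv \<omega> ` N" using image_iff_inv[OF inv_G] by (simp add: inv_inv_G)
  thus False using xN[OF inv_G[OF w(1)]] by (simp add: x_def)
qed

text \<open>The localization determines M: if \<open>x\<close> lies in M but its preimage t under
  \<sigma> does not, then 1/t lies in the localization while its image 1/x does not. So M is
  contained in its image under \<sigma>, and maximality gives equality.\<close>

lemma decomp_group_iff: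
  assumes M: "max_ideal_of S M"
  shows "\<sigma> \<in> decomp_group G S M \<longleftrightarrow> \<sigma> \<in> G \<and> \<sigma> ` M = M"
proof
  assume "\<sigma> \<in> decomp_group G S M"
  hence s: "\<sigma> \<in> G" and loc: "\<sigma> ` localize S M \<subseteq> localize S M" by (auto simp: decomp_group_def)
  have "M \<subseteq> \<sigma> ` M"
  proof
    fix x assume x: "x \<in> M"
    show "x \<in> \<sigma> ` M"
    proof (rule ccontr)
      assume n: "x \<notin> \<sigma> ` M"
      let ?t = "inv \<sigma> x"
      have x0: "x \<noteq> 0" using n max_idealD(2)[OF max_ideal_image[OF s M]] by auto
      have xS: "x \<in> S" using x max_idealD(1)[OF M] by auto
      have "?t \<in> S - M" using n image_iff_inv[OF s] aut_S[OF inv_G[OF s] xS] by simp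
      hence "1 / ?t \<in> localize S M" unfolding localize_def using SD(2) by blast
      hence "\<sigma> (1 / ?t) \<in> localize S M" using loc by blast
      then obtain a t where "a \<in> S" "t \<in> S - M" "1 / x = a / t"
        unfolding localize_def using s by (auto simp: aut_divide aut_1 app_inv)
      moreover from this have "t \<noteq> 0" using max_idealD(2)[OF M] by auto
      ultimately have "t = a * x" using x0 by (simp add: field_simps)
      thus False using \<open>t \<in> S - M\<close> \<open>a \<in> S\<close> x max_idealD(4)[OF M] by simp
    qed
  qed
  thus "\<sigma> \<in> G \<and> \<sigma> ` M = M" using s max_ideal_subset_eq[OF M max_ideal_image[OF s M]] by simp
next
  assume s: "\<sigma> \<in> G \<and> \<sigma> ` M = M"
  have "\<sigma> (a / t) \<in> localize S M" if "a \<in> S" "t \<in> S - M" for a t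
  proof -
    have "\<sigma> t \<notin> M" using that s image_iff_inv[of \<sigma> "\<sigma> t" M] by (simp add: inv_app)
    hence "\<sigma> a \<in> S" "\<sigma> t \<in> S - M" "\<sigma> (a / t) = \<sigma> a / \<sigma> t" using that s aut_S by (auto simp: aut_divide)
    thus ?thesis unfolding localize_def by blast
  qed
  thus "\<sigma> \<in> decomp_group G S M" using s by (auto simp: decomp_group_def localize_def)
qed

end

section \<open>The preorders of a cocycle\<close>

lemma graph_isomorphic_sym:
  assumes "graph_isomorphic g h"
  shows "graph_isomorphic h g"
proof -
  obtain u where hom: "graph_hom u g h" and bij: "bij_betw u (fst g) (fst h)"
    and refl: "\<And>x y. x \<in> fst g \<Longrightarrow> y \<in> fst g \<Longrightarrow> snd h (u x) (u y) \<Longrightarrow> snd g x y"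
    using assms by (auto simp: graph_isomorphic_def graph_iso_def)
  let ?v = "inv_into (fst g) u"
  have bij': "bij_betw ?v (fst h) (fst g)" using bij by (rule bij_betw_inv_into)
  have v: "?v x \<in> fst g" "u (?v x) = x" if "x \<in> fst h" for x
    using that bij bij' bij_betw_inv_into_right[OF bij] by (auto simp: bij_betw_def)
  have "graph_iso ?v h g"
    unfolding graph_iso_def graph_hom_def
    using bij' v refl hom by (auto simp: graph_hom_def) metis
  thus ?thesis unfolding graph_isomorphic_def by blast
qed

lemma graph_isomorphic_trans:
  assumes "graph_isomorphic g h" "graph_isomorphic h k"
  shows "graph_isomorphic g k"
proof -
  obtain u v where "graph_iso u g h" "graph_iso v h k" using assms unfolding graph_isomorphic_def by blast
  note uv = this[unfolded graph_iso_def graph_hom_def]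
  have "graph_iso (\<lambda>x. v (u x)) g k"
    unfolding graph_iso_def graph_hom_def
  proof (intro conjI ballI impI)
    show "bij_betw (\<lambda>x. v (u x)) (fst g) (fst k)"
      using uv bij_betw_trans[of u "fst g" "fst h" v "fst k"] by (simp add: comp_def)
  qed (use uv in blast)+
  thus ?thesis unfolding graph_isomorphic_def by blast
qed

locale galois_cocycle = galois_valuation G V
  for G :: "('k::field \<Rightarrow> 'k) set" and V :: "'k set" +
  fixes f :: "('k \<Rightarrow> 'k) \<Rightarrow> ('k \<Rightarrow> 'k) \<Rightarrow> 'k"
  assumes f: "norm_cocycle G (int_closure V) f"
begin

lemma f_S: "\<sigma> \<in> G \<Longrightarrow> \<tau> \<in> G \<Longrightarrow> f \<sigma> \<tau> \<in> S"
  and cocycle: "\<sigma> \<in> G \<Longrightarrow> \<tau> \<in> G \<Longrightarrow> \<gamma> \<in> G \<Longrightarrow> \<sigma> (f \<tau> \<gamma>) * f \<sigma> (\<tau> \<circ> \<gamma>) = f \<sigma> \<tau> * f (\<sigma> \<circ> \<tau>) \<gamma>"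
  and f_id: "\<sigma> \<in> G \<Longrightarrow> f id \<sigma> = 1" "\<sigma> \<in> G \<Longrightarrow> f \<sigma> id = 1"
  using f by (auto simp: norm_cocycle_def)

text \<open>The relation is kept on elements of G instead of cosets of H, so that the classes
  \<open>clsM\<close> and the cosets of \<open>HM\<close> can be compared through the same
  representatives.\<close>

definition eqM :: "'k set \<Rightarrow> ('k \<Rightarrow> 'k) \<Rightarrow> ('k \<Rightarrow> 'k) \<Rightarrow> bool" where
  "eqM M \<sigma> \<tau> \<longleftrightarrow> leM f M \<sigma> \<tau> \<and> leM f M \<tau> \<sigma>"

lemma unit_notin_max:
  assumes "max_ideal_of S M" "u \<in> units_of_sub S"
  shows "u \<notin> M"
  using assms(2) max_idealD(4)[OF assms(1), of "inverse u" u] max_idealD(6)[OF assms(1)]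
  by (auto simp: units_of_sub_def)

lemma aut_unit:
  assumes "\<sigma> \<in> G" "u \<in> units_of_sub S"
  shows "\<sigma> u \<in> units_of_sub S"
proof -
  have "\<sigma> u \<in> S" "\<sigma> u \<noteq> 0" "\<sigma> (inverse u) \<in> S"
    using assms aut_S by (auto simp: units_of_sub_def aut_eq_0_iff[OF assms(1)])
  thus ?thesis by (auto simp: units_of_sub_def aut_inverse[OF assms(1)])
qed

lemma id_Hgrp: "id \<in> Hgrp G S f"
  using id_G f_id[OF id_G] SD(2) by (auto simp: Hgrp_def units_of_sub_def inv_id)

section \<open>The preorder attached to one maximal ideal\<close>

context
  fixes M :: "'k set"
  assumes M: "max_ideal_of S M"
begin

abbreviation Z :: "('k \<Rightarrow> 'k) set" where "Z \<equiv> decomp_group G S M"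

lemma Z_iff: "\<sigma> \<in> Z \<longleftrightarrow> \<sigma> \<in> G \<and> \<sigma> ` M = M"
  using decomp_group_iff[OF M] .

lemma Z_G: "\<sigma> \<in> Z \<Longrightarrow> \<sigma> \<in> G" by (simp add: Z_iff)

lemma Z_app: "\<sigma> \<in> Z \<Longrightarrow> \<sigma> x \<in> M \<longleftrightarrow> x \<in> M"
  unfolding Z_iff by (metis image_iff_inv inv_app)

lemma Z_comp: "\<sigma> \<in> Z \<Longrightarrow> \<tau> \<in> Z \<Longrightarrow> \<sigma> \<circ> \<tau> \<in> Z" and Z_inv: "\<sigma> \<in> Z \<Longrightarrow> inv \<sigma> \<in> Z"
proof -
  show "\<sigma> \<in> Z \<Longrightarrow> \<tau> \<in> Z \<Longrightarrow> \<sigma> \<circ> \<tau> \<in> Z" unfolding Z_iff by (metis comp_G image_comp)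
  show "\<sigma> \<in> Z \<Longrightarrow> inv \<sigma> \<in> Z" unfolding Z_iff using inv_G image_image_inv(2) by metis
qed

lemma notin_mult: "x \<in> S \<Longrightarrow> y \<in> S \<Longrightarrow> x * y \<notin> M \<longleftrightarrow> x \<notin> M \<and> y \<notin> M"
  using max_ideal_prime[OF M] by blast

lemma leM_refl: "\<sigma> \<in> G \<Longrightarrow> leM f M \<sigma> \<sigma>"
  by (simp add: leM_def inv_comp f_id max_idealD(6)[OF M])

text \<open>The cocycle identity at \<sigma>, \<open>inv \<sigma> \<circ> \<tau>\<close>,
  \<open>inv \<tau> \<circ> \<gamma>\<close> exhibits the product of the two given values as a
  multiple of the wanted one; that product is outside M because M is prime.\<close>

lemma leM_trans:
  assumes st: "\<sigma> \<in> G" "\<tau> \<in> G" "\<gamma> \<in> G" and le: "leM f M \<sigma> \<tau>" "leM f M \<tau> \<gamma>"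
  shows "leM f M \<sigma> \<gamma>"
proof -
  have "\<sigma> (f (inv \<sigma> \<circ> \<tau>) (inv \<tau> \<circ> \<gamma>)) * f \<sigma> (inv \<sigma> \<circ> \<gamma>) = f \<sigma> (inv \<sigma> \<circ> \<tau>) * f \<tau> (inv \<tau> \<circ> \<gamma>)"
    using cocycle[of \<sigma> "inv \<sigma> \<circ> \<tau>" "inv \<tau> \<circ> \<gamma>"] st by (simp add: G_simps G_closed)
  moreover have "f \<sigma> (inv \<sigma> \<circ> \<tau>) * f \<tau> (inv \<tau> \<circ> \<gamma>) \<notin> M"
    using le st by (subst notin_mult) (auto simp: leM_def intro!: f_S G_closed)
  ultimately show ?thesis
    unfolding leM_def using st by (metis notin_mult aut_S f_S comp_G inv_G)
qed

lemma eqM_refl: "\<sigma> \<in> G \<Longrightarrow> eqM M \<sigma> \<sigma>"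
  and eqM_sym: "eqM M \<sigma> \<tau> \<Longrightarrow> eqM M \<tau> \<sigma>"
  and eqM_trans: "\<sigma> \<in> G \<Longrightarrow> \<tau> \<in> G \<Longrightarrow> \<gamma> \<in> G \<Longrightarrow> eqM M \<sigma> \<tau> \<Longrightarrow> eqM M \<tau> \<gamma> \<Longrightarrow> eqM M \<sigma> \<gamma>"
  unfolding eqM_def using leM_refl leM_trans by blast+

text \<open>With third argument \<open>inv \<tau> \<circ> \<sigma>\<close> the cocycle identity
  closes up to \<open>f \<sigma> id\<close>, which is 1, so the two comparison values multiply to a
  single conjugated cocycle value.\<close>

lemma eqM_iff:
  assumes st: "\<sigma> \<in> G" "\<tau> \<in> G"
  shows "eqM M \<sigma> \<tau> \<longleftrightarrow> \<sigma> (f (inv \<sigma> \<circ> \<tau>) (inv \<tau> \<circ> \<sigma>)) \<notin> M"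
proof -
  have "\<sigma> (f (inv \<sigma> \<circ> \<tau>) (inv \<tau> \<circ> \<sigma>)) = f \<sigma> (inv \<sigma> \<circ> \<tau>) * f \<tau> (inv \<tau> \<circ> \<sigma>)"
    using cocycle[of \<sigma> "inv \<sigma> \<circ> \<tau>" "inv \<tau> \<circ> \<sigma>"] st by (simp add: G_simps G_closed f_id)
  thus ?thesis using st by (simp add: eqM_def leM_def notin_mult f_S G_closed)
qed

text \<open>An element of the decomposition group stabilizes M, so the outer automorphism
  disappears; what remains is the condition that defines the map phi.\<close>

lemma eqM_Z_iff:
  assumes "d \<in> Z" "\<tau> \<in> G"
  shows "eqM M d \<tau> \<longleftrightarrow> f (inv d \<circ> \<tau>) (inv \<tau> \<circ> d) \<notin> M"
  using eqM_iff[OF Z_G[OF assms(1)] assms(2)] Z_app[OF assms(1)] by simp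

lemma phi_cond_iff: "\<sigma> \<in> G \<Longrightarrow> phi_cond G S f M \<sigma> d \<longleftrightarrow> d \<in> Z \<and> eqM M d \<sigma>"
  using eqM_Z_iff by (auto simp: phi_cond_def)

text \<open>Two representatives of a coset differ by some \<open>h\<close> in H on the right. The
  value \<open>f h (inv h)\<close> is a unit, and so is its image under \<sigma>, hence it avoids
  every maximal ideal. This makes the maps on \<open>Gr\<close> independent of
  representatives.\<close>

lemma eqM_if_lcoset_eq:
  assumes st: "\<sigma> \<in> G" "\<tau> \<in> G" and eq: "lcoset \<sigma> (Hgrp G S f) = lcoset \<tau> (Hgrp G S f)"
  shows "eqM M \<sigma> \<tau>"
proof -
  have "\<tau> \<in> lcoset \<tau> (Hgrp G S f)" unfolding lcoset_def by (rule image_eqI[OF _ id_Hgrp]) simp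
  hence "\<tau> \<in> lcoset \<sigma> (Hgrp G S f)" by (simp only: eq)
  then obtain h where h: "h \<in> Hgrp G S f" "\<tau> = \<sigma> \<circ> h" by (auto simp: lcoset_def)
  have "h \<in> G" using h by (simp add: Hgrp_def)
  have "inv \<sigma> \<circ> \<tau> = h" "inv \<tau> \<circ> \<sigma> = inv h"
    using h(2) st \<open>h \<in> G\<close> by (simp_all add: G_simps)
  moreover have "\<sigma> (f h (inv h)) \<notin> M"
    using h(1) unit_notin_max[OF M aut_unit[OF st(1)]] by (simp add: Hgrp_def)
  ultimately show ?thesis using eqM_iff[OF st] by simp
qed

lemma clsM_eq_iff:
  assumes st: "\<sigma> \<in> G" "\<tau> \<in> G"
  shows "clsM G S f M \<sigma> = clsM G S f M \<tau> \<longleftrightarrow> eqM M \<sigma> \<tau>"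
proof
  assume eq: "clsM G S f M \<sigma> = clsM G S f M \<tau>"
  have "lcoset \<sigma> (Hgrp G S f) \<in> clsM G S f M \<sigma>" using st leM_refl by (auto simp: clsM_def)
  \<comment> \<open>Membership in a class only yields some representative \<gamma> of the coset of
    \<sigma>, so the comparison of \<sigma> with \<gamma> has to be added.\<close>
  then obtain \<gamma> where g: "\<gamma> \<in> G" "eqM M \<tau> \<gamma>" "lcoset \<sigma> (Hgrp G S f) = lcoset \<gamma> (Hgrp G S f)"
    unfolding eq by (auto simp: clsM_def eqM_def)
  show "eqM M \<sigma> \<tau>" using eqM_if_lcoset_eq[OF st(1) g(1,3)] g st eqM_sym eqM_trans by blast
next
  assume e: "eqM M \<sigma> \<tau>"
  hence "leM f M \<sigma> \<gamma> \<and> leM f M \<gamma> \<sigma> \<longleftrightarrow> leM f M \<tau> \<gamma> \<and> leM f M \<gamma> \<tau>" if "\<gamma> \<in> G" for \<gamma>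
    using that st leM_trans unfolding eqM_def by blast
  thus "clsM G S f M \<sigma> = clsM G S f M \<tau>" unfolding clsM_def by blast
qed

text \<open>The graph relation only asks for some pair of representatives; transitivity lets any
  given pair decide it.\<close>

lemma GrSup_le_iff:
  assumes st: "\<sigma> \<in> G" "\<tau> \<in> G"
  shows "snd (GrSup G S f M) (clsM G S f M \<sigma>) (clsM G S f M \<tau>) \<longleftrightarrow> leM f M \<sigma> \<tau>"
proof
  assume "snd (GrSup G S f M) (clsM G S f M \<sigma>) (clsM G S f M \<tau>)"
  then obtain \<sigma>' \<tau>' where "\<sigma>' \<in> G" "\<tau>' \<in> G" "eqM M \<sigma> \<sigma>'" "eqM M \<tau> \<tau>'" "leM f M \<sigma>' \<tau>'"
    using st by (auto simp: GrSup_def clsM_eq_iff)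
  thus "leM f M \<sigma> \<tau>" using st leM_trans unfolding eqM_def by meson
qed (use st in \<open>auto simp: GrSup_def\<close>)

text \<open>For x in the coset of d, the quotient \<open>inv d \<circ> x\<close> is the element of
  \<open>HM\<close> that the equivalence criterion tests. The vertices of \<open>GrSub\<close> are
  thus the traces on the decomposition group of the classes in \<open>GrSup\<close>, which is why
  psi is injective.\<close>

lemma lcoset_HM:
  assumes d: "d \<in> Z"
  shows "lcoset d (HM G S f M) = {x \<in> Z. eqM M d x}"
proof (intro equalityI subsetI)
  fix x assume "x \<in> lcoset d (HM G S f M)"
  then obtain h where h: "h \<in> Z" "f h (inv h) \<notin> M" "x = d \<circ> h" by (auto simp: lcoset_def HM_def)
  have "x \<in> Z" using h d Z_comp by simp
  moreover have "eqM M d x"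
    using h d Z_G by (subst eqM_Z_iff) (auto simp: G_simps intro!: comp_G)
  ultimately show "x \<in> {x \<in> Z. eqM M d x}" by simp
next
  fix x assume x: "x \<in> {x \<in> Z. eqM M d x}"
  let ?h = "inv d \<circ> x"
  have "?h \<in> Z" using x d Z_comp Z_inv by simp
  moreover have "f ?h (inv ?h) \<notin> M" using x d eqM_Z_iff[of d x] Z_G by (simp add: G_simps G_closed)
  moreover have "x = d \<circ> ?h" using d Z_G by (simp add: G_simps)
  ultimately show "x \<in> lcoset d (HM G S f M)" by (auto simp: lcoset_def HM_def)
qed

lemma lcoset_HM_eq_iff:
  assumes d: "d \<in> Z" "d' \<in> Z"
  shows "lcoset d (HM G S f M) = lcoset d' (HM G S f M) \<longleftrightarrow> eqM M d d'"
proof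
  assume "lcoset d (HM G S f M) = lcoset d' (HM G S f M)"
  moreover have "d' \<in> lcoset d' (HM G S f M)" using d eqM_refl Z_G by (simp add: lcoset_HM)
  ultimately show "eqM M d d'" using d by (auto simp: lcoset_HM)
next
  assume "eqM M d d'"
  hence "eqM M d x \<longleftrightarrow> eqM M d' x" if "x \<in> Z" for x
    using that d Z_G eqM_sym eqM_trans by meson
  thus "lcoset d (HM G S f M) = lcoset d' (HM G S f M)" using d by (auto simp: lcoset_HM)
qed

lemma GrSub_le_iff:
  assumes d: "d \<in> Z" "d' \<in> Z"
  shows "snd (GrSub G S f M) (lcoset d (HM G S f M)) (lcoset d' (HM G S f M)) \<longleftrightarrow> leM f M d d'"
proof
  assume "snd (GrSub G S f M) (lcoset d (HM G S f M)) (lcoset d' (HM G S f M))"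
  then obtain \<sigma>' \<tau>' where "\<sigma>' \<in> Z" "\<tau>' \<in> Z" "eqM M d \<sigma>'" "eqM M d' \<tau>'" "leM f M \<sigma>' \<tau>'"
    using d by (auto simp: GrSub_def lcoset_HM_eq_iff leM_def)
  thus "leM f M d d'" using d Z_G leM_trans unfolding eqM_def by meson
qed (use d in \<open>auto simp: GrSub_def leM_def\<close>)

section \<open>The maps psi and c, and the coset criterion\<close>

lemma psiM_lcoset:
  assumes d: "d \<in> Z"
  shows "psiM G S f M (lcoset d (HM G S f M)) = clsM G S f M d"
proof -
  let ?P = "\<lambda>\<sigma>. \<sigma> \<in> Z \<and> lcoset d (HM G S f M) = lcoset \<sigma> (HM G S f M)"
  define \<sigma> where "\<sigma> = (SOME \<sigma>. ?P \<sigma>)"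
  have s: "?P \<sigma>" unfolding \<sigma>_def by (rule someI[of ?P d]) (use d in simp)
  hence "eqM M d \<sigma>" using lcoset_HM_eq_iff[OF d] by blast
  hence "clsM G S f M d = clsM G S f M \<sigma>" using clsM_eq_iff d s Z_G by blast
  thus ?thesis by (simp add: psiM_def \<sigma>_def)
qed

lemma cM_lcoset:
  assumes s: "\<sigma> \<in> G"
  shows "cM G S f M (lcoset \<sigma> (Hgrp G S f)) = clsM G S f M \<sigma>"
proof -
  let ?P = "\<lambda>\<tau>. \<tau> \<in> G \<and> lcoset \<sigma> (Hgrp G S f) = lcoset \<tau> (Hgrp G S f)"
  define \<tau> where "\<tau> = (SOME \<tau>. ?P \<tau>)"
  have t: "?P \<tau>" unfolding \<tau>_def by (rule someI[of ?P \<sigma>]) (use s in simp)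
  hence "eqM M \<sigma> \<tau>" using eqM_if_lcoset_eq[OF s] by blast
  hence "clsM G S f M \<sigma> = clsM G S f M \<tau>" using clsM_eq_iff s t by blast
  thus ?thesis by (simp add: cM_def \<tau>_def)
qed

lemma psi_iso_iff:
  "graph_iso (psiM G S f M) (GrSub G S f M) (GrSup G S f M) \<longleftrightarrow> (\<forall>\<sigma>\<in>G. \<exists>d\<in>Z. eqM M d \<sigma>)"
proof
  assume iso: "graph_iso (psiM G S f M) (GrSub G S f M) (GrSup G S f M)"
  show "\<forall>\<sigma>\<in>G. \<exists>d\<in>Z. eqM M d \<sigma>"
  proof
    fix \<sigma> assume s: "\<sigma> \<in> G"
    hence "clsM G S f M \<sigma> \<in> fst (GrSup G S f M)" by (auto simp: GrSup_def)
    also have "\<dots> = psiM G S f M ` fst (GrSub G S f M)" using iso by (simp add: graph_iso_def bij_betw_def)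
    finally obtain d where "d \<in> Z" "clsM G S f M \<sigma> = clsM G S f M d"
      by (auto simp: GrSub_def psiM_lcoset)
    thus "\<exists>d\<in>Z. eqM M d \<sigma>" using s Z_G clsM_eq_iff eqM_sym by blast
  qed
next
  assume surj: "\<forall>\<sigma>\<in>G. \<exists>d\<in>Z. eqM M d \<sigma>"
  have sub: "fst (GrSub G S f M) = (\<lambda>d. lcoset d (HM G S f M)) ` Z" by (auto simp: GrSub_def)
  have sup: "fst (GrSup G S f M) = clsM G S f M ` G" by (auto simp: GrSup_def)
  have "inj_on (psiM G S f M) (fst (GrSub G S f M))"
    unfolding sub
  proof (intro inj_onI, elim imageE)
    fix X Y d d' assume "psiM G S f M X = psiM G S f M Y" "X = lcoset d (HM G S f M)" "d \<in> Z"
      "Y = lcoset d' (HM G S f M)" "d' \<in> Z"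
    thus "X = Y" by (simp add: psiM_lcoset clsM_eq_iff Z_G lcoset_HM_eq_iff)
  qed
  moreover have "psiM G S f M ` fst (GrSub G S f M) = clsM G S f M ` Z"
    unfolding sub image_image by (intro image_cong refl psiM_lcoset)
  moreover have "clsM G S f M ` Z = clsM G S f M ` G"
  proof (intro equalityI image_subsetI)
    fix \<sigma> assume "\<sigma> \<in> G"
    then obtain d where "d \<in> Z" "eqM M d \<sigma>" using surj by blast
    thus "clsM G S f M \<sigma> \<in> clsM G S f M ` Z" using clsM_eq_iff[OF Z_G] \<open>\<sigma> \<in> G\<close> by (metis imageI)
  qed (use Z_G in blast)
  ultimately have "bij_betw (psiM G S f M) (fst (GrSub G S f M)) (fst (GrSup G S f M))"
    by (simp add: bij_betw_def sup)
  thus "graph_iso (psiM G S f M) (GrSub G S f M) (GrSup G S f M)"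
    unfolding graph_iso_def graph_hom_def sub sup
    by (auto simp: psiM_lcoset GrSub_le_iff GrSup_le_iff Z_G)
qed

lemma right_coset_eq:
  assumes "\<rho> \<in> (\<lambda>z. z \<circ> \<sigma>) ` Z"
  shows "(\<lambda>z. z \<circ> \<rho>) ` Z = (\<lambda>z. z \<circ> \<sigma>) ` Z"
proof -
  obtain z where z: "z \<in> Z" "\<rho> = z \<circ> \<sigma>" using assms by blast
  show ?thesis
  proof (intro equalityI image_subsetI)
    fix y assume y: "y \<in> Z"
    show "y \<circ> \<rho> \<in> (\<lambda>z. z \<circ> \<sigma>) ` Z"
      by (rule image_eqI[of _ _ "y \<circ> z"]) (use y z Z_comp in \<open>auto simp: comp_assoc\<close>)
    show "y \<circ> \<sigma> \<in> (\<lambda>z. z \<circ> \<rho>) ` Z"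
      by (rule image_eqI[of _ _ "y \<circ> inv z"]) (use y z Z_comp Z_inv Z_G in \<open>auto simp: G_simps\<close>)
  qed
qed

text \<open>The inverse explains why right cosets occur: as d runs through the decomposition group,
  \<open>inv d \<circ> \<sigma>\<close> runs through the right coset of \<sigma>.\<close>

lemma eqM_right_coset:
  assumes "z \<in> Z" "\<sigma> \<in> G"
  shows "eqM M (inv z) \<sigma> \<longleftrightarrow> f (z \<circ> \<sigma>) (inv (z \<circ> \<sigma>)) \<notin> M"
  using eqM_Z_iff[OF Z_inv[OF assms(1)] assms(2)] assms Z_G by (simp add: G_simps)

lemma right_coset_reps_iff:
  "(\<exists>R. right_coset_reps G Z R \<and> (\<forall>\<rho>\<in>R. f \<rho> (inv \<rho>) \<notin> M)) \<longleftrightarrow> (\<forall>\<sigma>\<in>G. \<exists>d\<in>Z. eqM M d \<sigma>)"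
proof
  assume "\<exists>R. right_coset_reps G Z R \<and> (\<forall>\<rho>\<in>R. f \<rho> (inv \<rho>) \<notin> M)"
  then obtain R where R: "right_coset_reps G Z R" "\<And>\<rho>. \<rho> \<in> R \<Longrightarrow> f \<rho> (inv \<rho>) \<notin> M" by blast
  show "\<forall>\<sigma>\<in>G. \<exists>d\<in>Z. eqM M d \<sigma>"
  proof
    fix \<sigma> assume s: "\<sigma> \<in> G"
    then obtain z where "z \<in> Z" "z \<circ> \<sigma> \<in> R" using R(1) unfolding right_coset_reps_def by blast
    thus "\<exists>d\<in>Z. eqM M d \<sigma>" using R(2) eqM_right_coset[OF _ s] Z_inv by blast
  qed
next
  assume surj: "\<forall>\<sigma>\<in>G. \<exists>d\<in>Z. eqM M d \<sigma>"
  let ?C = "\<lambda>\<sigma>. (\<lambda>z. z \<circ> \<sigma>) ` Z"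
  let ?P = "\<lambda>C \<rho>. \<rho> \<in> C \<and> f \<rho> (inv \<rho>) \<notin> M"
  \<comment> \<open>The choice depends on the coset as a set, so equal cosets receive the same
    representative; this gives uniqueness below.\<close>
  define r where "r C = (SOME \<rho>. ?P C \<rho>)" for C
  have r: "?P (?C \<sigma>) (r (?C \<sigma>))" if s: "\<sigma> \<in> G" for \<sigma>
  proof -
    obtain d where d: "d \<in> Z" "eqM M d \<sigma>" using surj s by blast
    have "?P (?C \<sigma>) (inv d \<circ> \<sigma>)"
      using eqM_right_coset[OF Z_inv[OF d(1)] s] d Z_inv[OF d(1)] inv_inv_G[OF Z_G[OF d(1)]] by auto
    thus ?thesis unfolding r_def by (rule someI[of "?P (?C \<sigma>)"])
  qed
  define R where "R = (\<lambda>\<sigma>. r (?C \<sigma>)) ` G"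
  have "right_coset_reps G Z R"
    unfolding right_coset_reps_def
  proof (intro conjI ballI)
    show "R \<subseteq> G" using r Z_G comp_G by (fastforce simp: R_def)
    fix \<sigma> assume s: "\<sigma> \<in> G"
    show "\<exists>!\<rho>. \<rho> \<in> R \<and> \<rho> \<in> ?C \<sigma>"
    proof (rule ex1I[of _ "r (?C \<sigma>)"])
      show "r (?C \<sigma>) \<in> R \<and> r (?C \<sigma>) \<in> ?C \<sigma>" using r[OF s] s by (auto simp: R_def)
      fix \<rho> assume a: "\<rho> \<in> R \<and> \<rho> \<in> ?C \<sigma>"
      then obtain \<tau> where t: "\<tau> \<in> G" "\<rho> = r (?C \<tau>)" by (auto simp: R_def)
      \<comment> \<open>\<rho> lies in both right cosets, so each of them equals the right coset of
        \<rho>.\<close>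
      have "?C \<tau> = ?C \<sigma>" using right_coset_eq[of \<rho> \<tau>] right_coset_eq[of \<rho> \<sigma>] a r[OF t(1)] t(2) by simp
      thus "\<rho> = r (?C \<sigma>)" using t(2) by simp
    qed
  qed
  moreover have "\<forall>\<rho>\<in>R. f \<rho> (inv \<rho>) \<notin> M" using r by (auto simp: R_def)
  ultimately show "\<exists>R. right_coset_reps G Z R \<and> (\<forall>\<rho>\<in>R. f \<rho> (inv \<rho>) \<notin> M)" by blast
qed

section \<open>The map phi when every class meets the decomposition group\<close>

context
  assumes surj: "\<forall>\<sigma>\<in>G. \<exists>d\<in>Z. eqM M d \<sigma>"
begin

lemma phi_well_defined: "phi_well_defined G S f M"
  unfolding phi_well_defined_def
proof (intro conjI ballI allI impI)
  fix \<sigma> assume "\<sigma> \<in> G"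
  thus "\<exists>d. phi_cond G S f M \<sigma> d" using surj phi_cond_iff by blast
next
  fix \<sigma> \<sigma>' d d'
  assume s: "\<sigma> \<in> G" "\<sigma>' \<in> G"
    and a: "lcoset \<sigma> (Hgrp G S f) = lcoset \<sigma>' (Hgrp G S f) \<and> phi_cond G S f M \<sigma> d \<and> phi_cond G S f M \<sigma>' d'"
  hence d: "d \<in> Z" "d' \<in> Z" "eqM M d \<sigma>" "eqM M d' \<sigma>'" "eqM M \<sigma> \<sigma>'"
    using phi_cond_iff eqM_if_lcoset_eq by auto
  hence "eqM M d d'" using s Z_G eqM_sym eqM_trans by meson
  thus "lcoset d (HM G S f M) = lcoset d' (HM G S f M)" using d lcoset_HM_eq_iff by simp
qed

lemma phiN_lcoset:
  assumes s: "\<sigma> \<in> G"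
  obtains d where "d \<in> Z" "eqM M d \<sigma>" "phiN G S f M (lcoset \<sigma> (Hgrp G S f)) = lcoset d (HM G S f M)"
proof -
  let ?P = "\<lambda>\<tau>. \<tau> \<in> G \<and> lcoset \<sigma> (Hgrp G S f) = lcoset \<tau> (Hgrp G S f)"
  define \<tau> where "\<tau> = (SOME \<tau>. ?P \<tau>)"
  have t: "?P \<tau>" unfolding \<tau>_def by (rule someI[of ?P \<sigma>]) (use s in simp)
  define d where "d = (SOME d. phi_cond G S f M \<tau> d)"
  have "\<exists>d. phi_cond G S f M \<tau> d" using t surj phi_cond_iff by blast
  hence "phi_cond G S f M \<tau> d" unfolding d_def by (rule someI_ex)
  hence d: "d \<in> Z" "eqM M d \<tau>" using t phi_cond_iff by auto
  moreover have "eqM M \<tau> \<sigma>" using t s eqM_if_lcoset_eq by auto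
  ultimately have "eqM M d \<sigma>" using eqM_trans t s Z_G by blast
  moreover have "phiN G S f M (lcoset \<sigma> (Hgrp G S f)) = lcoset d (HM G S f M)"
    unfolding phiN_def Let_def d_def \<tau>_def ..
  ultimately show ?thesis using that d(1) by blast
qed

lemma psi_phi_eq_c:
  assumes "X \<in> fst (Gr G S f)"
  shows "psiM G S f M (phiN G S f M X) = cM G S f M X"
proof -
  obtain \<sigma> where s: "\<sigma> \<in> G" "X = lcoset \<sigma> (Hgrp G S f)" using assms by (auto simp: Gr_def)
  obtain d where d: "d \<in> Z" "eqM M d \<sigma>" "phiN G S f M X = lcoset d (HM G S f M)"
    using phiN_lcoset[OF s(1)] s(2) by metis
  have "psiM G S f M (phiN G S f M X) = clsM G S f M d" using d psiM_lcoset by simp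
  also have "\<dots> = clsM G S f M \<sigma>" using d s Z_G clsM_eq_iff by simp
  also have "\<dots> = cM G S f M X" using s cM_lcoset by simp
  finally show ?thesis .
qed

text \<open>A unit avoids M, so an edge of \<open>Gr\<close> is a comparison for \<open>leM\<close>,
  and passing to equivalent elements of the decomposition group keeps it. For surjectivity, an
  element d of that group is its own admissible choice, so its H-coset goes to its
  \<open>HM\<close>-coset.\<close>

lemma phi_epi: "graph_epi (phiN G S f M) (Gr G S f) (GrSub G S f M)"
proof -
  have Gr: "fst (Gr G S f) = (\<lambda>\<sigma>. lcoset \<sigma> (Hgrp G S f)) ` G" by (auto simp: Gr_def)
  have sub: "fst (GrSub G S f M) = (\<lambda>d. lcoset d (HM G S f M)) ` Z" by (auto simp: GrSub_def)
  have mem: "phiN G S f M X \<in> fst (GrSub G S f M)" if "X \<in> fst (Gr G S f)" for X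
  proof -
    obtain \<sigma> where "\<sigma> \<in> G" "X = lcoset \<sigma> (Hgrp G S f)" using \<open>X \<in> fst (Gr G S f)\<close> unfolding Gr by blast
    thus ?thesis unfolding sub using phiN_lcoset[of \<sigma>] by (metis imageI)
  qed
  have "snd (GrSub G S f M) (phiN G S f M X) (phiN G S f M Y)" if "snd (Gr G S f) X Y" for X Y
  proof -
    obtain \<sigma> \<tau> where st: "\<sigma> \<in> G" "\<tau> \<in> G" "X = lcoset \<sigma> (Hgrp G S f)" "Y = lcoset \<tau> (Hgrp G S f)"
        "f \<sigma> (inv \<sigma> \<circ> \<tau>) \<in> units_of_sub S"
      using \<open>snd (Gr G S f) X Y\<close> by (auto simp: Gr_def)
    have "leM f M \<sigma> \<tau>" using unit_notin_max[OF M st(5)] by (simp add: leM_def)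
    moreover obtain d where d: "d \<in> Z" "eqM M d \<sigma>" "phiN G S f M X = lcoset d (HM G S f M)"
      using phiN_lcoset[OF st(1)] st(3) by metis
    moreover obtain d' where d': "d' \<in> Z" "eqM M d' \<tau>" "phiN G S f M Y = lcoset d' (HM G S f M)"
      using phiN_lcoset[OF st(2)] st(4) by metis
    ultimately have "leM f M d d'" using st Z_G leM_trans unfolding eqM_def by meson
    thus ?thesis using d d' GrSub_le_iff by simp
  qed
  moreover have "fst (GrSub G S f M) \<subseteq> phiN G S f M ` fst (Gr G S f)"
  proof
    fix Y assume "Y \<in> fst (GrSub G S f M)"
    then obtain d where d: "d \<in> Z" "Y = lcoset d (HM G S f M)" unfolding sub by blast
    obtain d' where "d' \<in> Z" "eqM M d' d" "phiN G S f M (lcoset d (Hgrp G S f)) = lcoset d' (HM G S f M)"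
      using phiN_lcoset[OF Z_G[OF d(1)]] by metis
    hence "phiN G S f M (lcoset d (Hgrp G S f)) = Y" using d lcoset_HM_eq_iff by simp
    thus "Y \<in> phiN G S f M ` fst (Gr G S f)" using d Z_G unfolding Gr by blast
  qed
  ultimately show ?thesis using mem unfolding graph_epi_def graph_hom_def by auto
qed

end

end

text \<open>Left multiplication by an automorphism carrying N to M preserves and reflects the preorders as soon as
  its cocycle value at its inverse lies outside M, because then no cocycle value at it lies in M.\<close>
lemma leM_translate:
  assumes N: "max_ideal_of S N" and w: "\<omega> \<in> G" "f \<omega> (inv \<omega>) \<notin> \<omega> ` N"
    and st: "\<sigma> \<in> G" "\<tau> \<in> G"
  shows "leM f (\<omega> ` N) (\<omega> \<circ> \<sigma>) (\<omega> \<circ> \<tau>) \<longleftrightarrow> leM f N \<sigma> \<tau>"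
proof -
  let ?M = "\<omega> ` N"
  have M: "max_ideal_of S ?M" using max_ideal_image[OF w(1) N] .
  \<comment> \<open>By the cocycle identity at \<omega>, \<open>inv \<omega>\<close>,
    \<open>\<omega> \<circ> \<gamma>\<close>, every \<open>f \<omega> \<gamma>\<close> divides
    \<open>f \<omega> (inv \<omega>)\<close> in S.\<close>
  have no: "f \<omega> \<gamma> \<notin> ?M" if g: "\<gamma> \<in> G" for \<gamma>
  proof -
    have "\<omega> (f (inv \<omega>) (\<omega> \<circ> \<gamma>)) * f \<omega> \<gamma> = f \<omega> (inv \<omega>)"
      using cocycle[of \<omega> "inv \<omega>" "\<omega> \<circ> \<gamma>"] g w by (simp add: G_simps G_closed f_id)
    thus ?thesis using w g notin_mult[OF M] by (metis aut_S f_S comp_G inv_G)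
  qed
  have e: "\<omega> (f \<sigma> (inv \<sigma> \<circ> \<tau>)) * f \<omega> \<tau> = f \<omega> \<sigma> * f (\<omega> \<circ> \<sigma>) (inv \<sigma> \<circ> \<tau>)"
    using cocycle[of \<omega> \<sigma> "inv \<sigma> \<circ> \<tau>"] st w by (simp add: G_simps G_closed)
  have "leM f ?M (\<omega> \<circ> \<sigma>) (\<omega> \<circ> \<tau>) \<longleftrightarrow> f (\<omega> \<circ> \<sigma>) (inv \<sigma> \<circ> \<tau>) \<notin> ?M"
    using st w by (simp add: leM_def G_simps G_closed)
  also have "\<dots> \<longleftrightarrow> f \<omega> \<sigma> * f (\<omega> \<circ> \<sigma>) (inv \<sigma> \<circ> \<tau>) \<notin> ?M"
    using st w no by (simp add: notin_mult[OF M] f_S G_closed)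
  also have "\<dots> \<longleftrightarrow> \<omega> (f \<sigma> (inv \<sigma> \<circ> \<tau>)) \<notin> ?M"
    unfolding e[symmetric] using st w no by (simp add: notin_mult[OF M] f_S aut_S G_closed)
  also have "\<dots> \<longleftrightarrow> leM f N \<sigma> \<tau>"
    using w by (simp add: image_iff_inv inv_app leM_def)
  finally show ?thesis .
qed

text \<open>The cocycle identity at \<omega>, \<open>inv \<omega>\<close>, \<omega> shows that
  \<omega> maps one of the two values to the other. A condition at the image of N can so be tested
  at N itself.\<close>

lemma f_inv_image:
  assumes "\<omega> \<in> G"
  shows "f \<omega> (inv \<omega>) \<in> \<omega> ` N \<longleftrightarrow> f (inv \<omega>) \<omega> \<in> N"
proof -
  have "\<omega> (f (inv \<omega>) \<omega>) = f \<omega> (inv \<omega>)"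
    using cocycle[of \<omega> "inv \<omega>" \<omega>] assms by (simp add: G_simps G_closed f_id)
  thus ?thesis using image_iff_inv[OF assms] inv_app[OF assms] by metis
qed

text \<open>Surjectivity at N improves an automorphism from N to M to one with good cocycle value.
  Translation by it yields the graph isomorphism, and conjugation by it yields the required elements
  of the decomposition group of M.\<close>

lemma surj_transfer:
  assumes M: "max_ideal_of S M" and N: "max_ideal_of S N"
    and surj: "\<forall>\<sigma>\<in>G. \<exists>d\<in>decomp_group G S N. eqM N d \<sigma>"
  shows "graph_isomorphic (GrSup G S f N) (GrSup G S f M)"
    and "\<forall>\<sigma>\<in>G. \<exists>d\<in>decomp_group G S M. eqM M d \<sigma>"
proof -
  obtain \<omega>0 where w0: "\<omega>0 \<in> G" "M = \<omega>0 ` N" using max_ideal_transitive[OF M N] .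
  \<comment> \<open>Right multiplication by an element stabilizing N does not change the image of N.
    Choosing d equivalent to \<open>inv \<omega>0\<close> makes the cocycle value of the corrected
    automorphism avoid the ideal.\<close>
  obtain d where d: "d \<in> decomp_group G S N" "eqM N d (inv \<omega>0)" using surj inv_G[OF w0(1)] by blast
  have dG: "d \<in> G" "d ` N = N" using d decomp_group_iff[OF N] by auto
  define \<omega> where "\<omega> = \<omega>0 \<circ> d"
  have w: "\<omega> \<in> G" using w0 dG by (simp add: \<omega>_def comp_G)
  have Mw: "M = \<omega> ` N" using w0 dG by (simp only: \<omega>_def image_comp[symmetric])
  have "f (inv \<omega>) \<omega> \<notin> N"
    using eqM_Z_iff[OF N d(1) inv_G[OF w0(1)]] d(2) w0(1) dG by (simp add: \<omega>_def G_simps)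
  hence fw: "f \<omega> (inv \<omega>) \<notin> \<omega> ` N" using f_inv_image[OF w] by simp
  note tr = leM_translate[OF N w fw, folded Mw]
  have eq: "eqM M (\<omega> \<circ> \<sigma>) (\<omega> \<circ> \<tau>) \<longleftrightarrow> eqM N \<sigma> \<tau>" if "\<sigma> \<in> G" "\<tau> \<in> G" for \<sigma> \<tau>
    using tr that by (simp add: eqM_def)
  define h where "h A = clsM G S f M (\<omega> \<circ> (SOME \<sigma>. \<sigma> \<in> G \<and> A = clsM G S f N \<sigma>))" for A
  have h: "h (clsM G S f N \<sigma>) = clsM G S f M (\<omega> \<circ> \<sigma>)" if s: "\<sigma> \<in> G" for \<sigma>
  proof -
    let ?P = "\<lambda>\<tau>. \<tau> \<in> G \<and> clsM G S f N \<sigma> = clsM G S f N \<tau>"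
    define \<tau> where "\<tau> = (SOME \<tau>. ?P \<tau>)"
    have t: "?P \<tau>" unfolding \<tau>_def by (rule someI[of ?P \<sigma>]) (use s in simp)
    hence "eqM M (\<omega> \<circ> \<sigma>) (\<omega> \<circ> \<tau>)" using s clsM_eq_iff[OF N] eq by blast
    hence "clsM G S f M (\<omega> \<circ> \<sigma>) = clsM G S f M (\<omega> \<circ> \<tau>)" using clsM_eq_iff[OF M] s t w comp_G by blast
    thus ?thesis by (simp add: h_def \<tau>_def)
  qed
  have sup: "fst (GrSup G S f L) = clsM G S f L ` G" for L by (auto simp: GrSup_def)
  have "inj_on h (clsM G S f N ` G)"
  proof (intro inj_onI, elim imageE)
    fix A B \<sigma> \<tau> assume "h A = h B" "A = clsM G S f N \<sigma>" "\<sigma> \<in> G" "B = clsM G S f N \<tau>" "\<tau> \<in> G"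
    thus "A = B" by (simp add: h clsM_eq_iff[OF M] clsM_eq_iff[OF N] comp_G w eq)
  qed
  moreover have "h ` clsM G S f N ` G = clsM G S f M ` G"
  proof (intro equalityI subsetI)
    fix A assume "A \<in> clsM G S f M ` G"
    then obtain \<sigma> where s: "\<sigma> \<in> G" "A = clsM G S f M \<sigma>" by blast
    hence "A = h (clsM G S f N (inv \<omega> \<circ> \<sigma>))" using w by (simp add: h G_simps G_closed)
    thus "A \<in> h ` clsM G S f N ` G" using s w by (auto intro!: G_closed)
  qed (use w in \<open>auto simp: h intro!: comp_G\<close>)
  ultimately have "bij_betw h (fst (GrSup G S f N)) (fst (GrSup G S f M))" by (simp add: bij_betw_def sup)
  hence "graph_iso h (GrSup G S f N) (GrSup G S f M)"
    unfolding graph_iso_def graph_hom_def sup using w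
    by (auto simp: h GrSup_le_iff[OF M] GrSup_le_iff[OF N] tr comp_G)
  thus "graph_isomorphic (GrSup G S f N) (GrSup G S f M)" by (auto simp: graph_isomorphic_def)
  show "\<forall>\<sigma>\<in>G. \<exists>d\<in>decomp_group G S M. eqM M d \<sigma>"
  proof
    fix \<sigma> assume s: "\<sigma> \<in> G"
    then obtain c where c: "c \<in> decomp_group G S N" "eqM N c (inv \<omega> \<circ> \<sigma>)"
      using surj w comp_G inv_G by blast
    have cG: "c \<in> G" "c ` N = N" using c decomp_group_iff[OF N] by auto
    \<comment> \<open>Translating c alone would give \<open>\<omega> \<circ> c\<close>, which
      carries N to M and need not stabilize M. The good value at \<omega> allows c to be replaced by
      \<open>c \<circ> inv \<omega>\<close>, whose translate is a conjugate of c and stabilizes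
      M.\<close>
    have "eqM N c (c \<circ> inv \<omega>)"
      using eqM_Z_iff[OF N c(1), of "c \<circ> inv \<omega>"] cG w \<open>f (inv \<omega>) \<omega> \<notin> N\<close> by (simp add: G_simps G_closed)
    hence "eqM N (c \<circ> inv \<omega>) (inv \<omega> \<circ> \<sigma>)"
      using c(2) eqM_sym[OF N] eqM_trans[OF N] cG w s comp_G inv_G by meson
    hence "eqM M (\<omega> \<circ> (c \<circ> inv \<omega>)) \<sigma>"
      using eq[of "c \<circ> inv \<omega>" "inv \<omega> \<circ> \<sigma>"] cG w s by (simp add: G_simps G_closed)
    moreover have "(\<omega> \<circ> (c \<circ> inv \<omega>)) ` M = M"
      by (simp only: Mw image_comp[symmetric] image_image_inv(2)[OF w] cG(2))
    hence "\<omega> \<circ> (c \<circ> inv \<omega>) \<in> decomp_group G S M"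
      using cG w by (simp add: decomp_group_iff[OF M] comp_G inv_G)
    ultimately show "\<exists>d\<in>decomp_group G S M. eqM M d \<sigma>" by blast
  qed
qed

end

section \<open>Crossed product orders\<close>

context galois_cocycle
begin

abbreviation A :: "(('k \<Rightarrow> 'k) \<Rightarrow> 'k) set" where "A \<equiv> cp_carrier G S"

text \<open>This embeds S into A_f through the coefficient at \<open>id\<close>; because f is
  normalized, \<open>scal 1\<close> is the identity of A_f.\<close>

definition scal :: "'k \<Rightarrow> ('k \<Rightarrow> 'k) \<Rightarrow> 'k" where
  "scal s = (\<lambda>\<sigma>. if \<sigma> = id then s else 0)"

lemma A_app: "a \<in> A \<Longrightarrow> a \<sigma> \<in> S"
  using SD(1) by (cases "\<sigma> \<in> G") (auto simp: cp_carrier_def)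

lemma A_outside: "a \<in> A \<Longrightarrow> \<sigma> \<notin> G \<Longrightarrow> a \<sigma> = 0"
  by (auto simp: cp_carrier_def)

lemma scal_A: "s \<in> S \<Longrightarrow> scal s \<in> A"
  using id_G SD(1) by (auto simp: cp_carrier_def scal_def)

section \<open>Multiplication in A_f\<close>

lemma cp_mult_term_S:
  assumes ab: "a \<in> A" "b \<in> A" and s: "\<sigma> \<in> G" and r: "\<rho> \<in> G"
  shows "a \<sigma> * \<sigma> (b (inv \<sigma> \<circ> \<rho>)) * f \<sigma> (inv \<sigma> \<circ> \<rho>) \<in> S"
proof -
  have "\<sigma> (b (inv \<sigma> \<circ> \<rho>)) \<in> S" by (rule aut_S[OF s A_app[OF ab(2)]])
  moreover have "f \<sigma> (inv \<sigma> \<circ> \<rho>) \<in> S" by (rule f_S[OF s comp_G[OF inv_G[OF s] r]])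
  ultimately show ?thesis using SD(4) A_app[OF ab(1)] by blast
qed

lemma cp_mult_A: "a \<in> A \<Longrightarrow> b \<in> A \<Longrightarrow> cp_mult G f a b \<in> A"
proof -
  assume ab: "a \<in> A" "b \<in> A"
  have "cp_mult G f a b \<rho> \<in> S" if r: "\<rho> \<in> G" for \<rho>
    using subring_set_sum[OF subring_S cp_mult_term_S[OF ab _ r]] r by (simp add: cp_mult_def)
  moreover have "cp_mult G f a b \<rho> = 0" if "\<rho> \<notin> G" for \<rho> using that by (simp add: cp_mult_def)
  ultimately show ?thesis unfolding cp_carrier_def[of G S] by blast
qed

lemma add_A: "a \<in> A \<Longrightarrow> b \<in> A \<Longrightarrow> (\<lambda>\<rho>. a \<rho> + b \<rho>) \<in> A"
  by (auto simp: cp_carrier_def intro: SD(3))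

lemma cp_mult_add_left: "cp_mult G f (\<lambda>\<rho>. a \<rho> + b \<rho>) c = (\<lambda>\<rho>. cp_mult G f a c \<rho> + cp_mult G f b c \<rho>)"
  by (auto simp: cp_mult_def fun_eq_iff distrib_right sum.distrib)

lemma cp_mult_add_right: "cp_mult G f a (\<lambda>\<rho>. b \<rho> + c \<rho>) = (\<lambda>\<rho>. cp_mult G f a b \<rho> + cp_mult G f a c \<rho>)"
proof
  fix \<rho>
  have "a \<sigma> * \<sigma> (b (inv \<sigma> \<circ> \<rho>) + c (inv \<sigma> \<circ> \<rho>)) * f \<sigma> (inv \<sigma> \<circ> \<rho>) =
      a \<sigma> * \<sigma> (b (inv \<sigma> \<circ> \<rho>)) * f \<sigma> (inv \<sigma> \<circ> \<rho>) + a \<sigma> * \<sigma> (c (inv \<sigma> \<circ> \<rho>)) * f \<sigma> (inv \<sigma> \<circ> \<rho>)"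
    if "\<sigma> \<in> G" for \<sigma>
    by (simp add: aut_add[OF that] algebra_simps)
  thus "cp_mult G f a (\<lambda>\<rho>. b \<rho> + c \<rho>) \<rho> = cp_mult G f a b \<rho> + cp_mult G f a c \<rho>"
    by (simp add: cp_mult_def flip: sum.distrib)
qed

lemma cp_mult_scal_left:
  assumes "a \<in> A"
  shows "cp_mult G f (scal s) a = (\<lambda>\<rho>. s * a \<rho>)"
proof
  fix \<rho>
  show "cp_mult G f (scal s) a \<rho> = s * a \<rho>"
  proof (cases "\<rho> \<in> G")
    case True
    have "cp_mult G f (scal s) a \<rho> = (\<Sum>\<sigma>\<in>G. if \<sigma> = id then s * a \<rho> else 0)"
      unfolding cp_mult_def using True by (auto simp: scal_def inv_id f_id intro!: sum.cong)
    thus ?thesis using finite_G id_G by simp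
  qed (simp add: cp_mult_def A_outside[OF assms])
qed

lemma cp_mult_scal_right:
  assumes "a \<in> A"
  shows "cp_mult G f a (scal s) = (\<lambda>\<rho>. a \<rho> * \<rho> s)"
proof
  fix \<rho>
  show "cp_mult G f a (scal s) \<rho> = a \<rho> * \<rho> s"
  proof (cases "\<rho> \<in> G")
    case True
    have "a \<sigma> * \<sigma> (scal s (inv \<sigma> \<circ> \<rho>)) * f \<sigma> (inv \<sigma> \<circ> \<rho>) = (if \<sigma> = \<rho> then a \<rho> * \<rho> s else 0)"
      if s: "\<sigma> \<in> G" for \<sigma>
    proof (cases "\<sigma> = \<rho>")
      case False
      hence "inv \<sigma> \<circ> \<rho> \<noteq> id" using comp_inv_cancel[OF s, of \<rho>] by auto
      thus ?thesis using False by (simp add: scal_def aut_0[OF s])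
    qed (simp add: inv_comp True scal_def f_id)
    hence "cp_mult G f a (scal s) \<rho> = (\<Sum>\<sigma>\<in>G. if \<sigma> = \<rho> then a \<rho> * \<rho> s else 0)"
      unfolding cp_mult_def using True by simp
    thus ?thesis using finite_G True by simp
  qed (simp add: cp_mult_def A_outside[OF assms])
qed

text \<open>After exchanging the two sums and substituting \<sigma> as \<tau> followed on the right
  by \<gamma>, corresponding terms agree by the cocycle identity at \<tau>,
  \<open>inv \<tau> \<circ> \<sigma>\<close>, \<open>inv \<sigma> \<circ> \<rho>\<close>.\<close>

lemma cp_mult_assoc: "cp_mult G f (cp_mult G f a b) c = cp_mult G f a (cp_mult G f b c)"
proof
  fix \<rho>
  show "cp_mult G f (cp_mult G f a b) c \<rho> = cp_mult G f a (cp_mult G f b c) \<rho>"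
  proof (cases "\<rho> \<in> G")
    case r: True
    let ?t = "\<lambda>\<tau> \<sigma>. a \<tau> * \<tau> (b (inv \<tau> \<circ> \<sigma>)) * f \<tau> (inv \<tau> \<circ> \<sigma>) * \<sigma> (c (inv \<sigma> \<circ> \<rho>)) * f \<sigma> (inv \<sigma> \<circ> \<rho>)"
    have "cp_mult G f (cp_mult G f a b) c \<rho> = (\<Sum>\<sigma>\<in>G. \<Sum>\<tau>\<in>G. ?t \<tau> \<sigma>)"
      using r by (simp add: cp_mult_def sum_distrib_right)
    also have "\<dots> = (\<Sum>\<tau>\<in>G. \<Sum>\<sigma>\<in>G. ?t \<tau> \<sigma>)" by (rule sum.swap)
    also have "\<dots> = (\<Sum>\<tau>\<in>G. a \<tau> * \<tau> (cp_mult G f b c (inv \<tau> \<circ> \<rho>)) * f \<tau> (inv \<tau> \<circ> \<rho>))"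
    proof (rule sum.cong[OF refl])
      fix \<tau> assume t: "\<tau> \<in> G"
      let ?u = "\<lambda>\<gamma>. b \<gamma> * \<gamma> (c (inv \<gamma> \<circ> (inv \<tau> \<circ> \<rho>))) * f \<gamma> (inv \<gamma> \<circ> (inv \<tau> \<circ> \<rho>))"
      have "(\<Sum>\<sigma>\<in>G. ?t \<tau> \<sigma>) = (\<Sum>\<gamma>\<in>G. a \<tau> * \<tau> (?u \<gamma>) * f \<tau> (inv \<tau> \<circ> \<rho>))"
      proof (rule sum.reindex_bij_witness[of _ "\<lambda>\<gamma>. \<tau> \<circ> \<gamma>" "\<lambda>\<sigma>. inv \<tau> \<circ> \<sigma>"])
        fix \<sigma> assume s: "\<sigma> \<in> G"
        show "\<tau> \<circ> (inv \<tau> \<circ> \<sigma>) = \<sigma>" "inv \<tau> \<circ> \<sigma> \<in> G" "inv \<tau> \<circ> (\<tau> \<circ> \<sigma>) = \<sigma>" "\<tau> \<circ> \<sigma> \<in> G"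
          using s t by (simp_all add: G_simps G_closed)
        have inv: "inv (inv \<tau> \<circ> \<sigma>) \<circ> (inv \<tau> \<circ> \<rho>) = inv \<sigma> \<circ> \<rho>"
          using s t by (simp add: G_simps G_closed)
        have c: "\<tau> (f (inv \<tau> \<circ> \<sigma>) (inv \<sigma> \<circ> \<rho>)) * f \<tau> (inv \<tau> \<circ> \<rho>) = f \<tau> (inv \<tau> \<circ> \<sigma>) * f \<sigma> (inv \<sigma> \<circ> \<rho>)"
          using cocycle[of \<tau> "inv \<tau> \<circ> \<sigma>" "inv \<sigma> \<circ> \<rho>"] s t r by (simp add: G_simps G_closed)
        have "a \<tau> * \<tau> (?u (inv \<tau> \<circ> \<sigma>)) * f \<tau> (inv \<tau> \<circ> \<rho>) =
            a \<tau> * \<tau> (b (inv \<tau> \<circ> \<sigma>)) * \<sigma> (c (inv \<sigma> \<circ> \<rho>)) * (\<tau> (f (inv \<tau> \<circ> \<sigma>) (inv \<sigma> \<circ> \<rho>)) * f \<tau> (inv \<tau> \<circ> \<rho>))"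
          unfolding inv by (simp add: aut_mult[OF t] app_inv[OF t] mult_ac)
        also have "\<dots> = ?t \<tau> \<sigma>" unfolding c by (simp add: mult_ac)
        finally show "a \<tau> * \<tau> (?u (inv \<tau> \<circ> \<sigma>)) * f \<tau> (inv \<tau> \<circ> \<rho>) = ?t \<tau> \<sigma>" .
      qed
      also have "\<dots> = a \<tau> * \<tau> (cp_mult G f b c (inv \<tau> \<circ> \<rho>)) * f \<tau> (inv \<tau> \<circ> \<rho>)"
        using comp_G[OF inv_G[OF t] r]
        by (simp add: cp_mult_def aut_sum[OF t] sum_distrib_left sum_distrib_right)
      finally show "(\<Sum>\<sigma>\<in>G. ?t \<tau> \<sigma>) = a \<tau> * \<tau> (cp_mult G f b c (inv \<tau> \<circ> \<rho>)) * f \<tau> (inv \<tau> \<circ> \<rho>)" .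
    qed
    also have "\<dots> = cp_mult G f a (cp_mult G f b c) \<rho>" using r by (simp add: cp_mult_def)
    finally show ?thesis .
  qed (simp add: cp_mult_def)
qed

section \<open>Left ideals of A_f\<close>

lemma left_idealD:
  assumes "cp_left_ideal G S f L"
  shows "L \<subseteq> A" "(\<lambda>_. 0) \<in> L" "x \<in> L \<Longrightarrow> y \<in> L \<Longrightarrow> (\<lambda>\<rho>. x \<rho> + y \<rho>) \<in> L"
    "a \<in> A \<Longrightarrow> x \<in> L \<Longrightarrow> cp_mult G f a x \<in> L"
  using assms by (auto simp: cp_left_ideal_def)

lemma left_ideal_eq_A_iff:
  assumes L: "cp_left_ideal G S f L"
  shows "L = A \<longleftrightarrow> scal 1 \<in> L"
proof
  assume one: "scal 1 \<in> L"
  have "a \<in> L" if "a \<in> A" for a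
  proof -
    have "(\<lambda>\<rho>. a \<rho> * \<rho> 1) = a"
    proof
      show "a \<rho> * \<rho> 1 = a \<rho>" for \<rho> using A_outside[OF that] by (cases "\<rho> \<in> G") (auto simp: aut_1)
    qed
    thus ?thesis using left_idealD(4)[OF L that one] cp_mult_scal_right[OF that, of 1] by simp
  qed
  thus "L = A" using left_idealD(1)[OF L] by blast
qed (use scal_A[OF SD(2)] in blast)

text \<open>Properness is expressed by the absence of \<open>scal 1\<close>, a condition that
  survives unions of chains, so Zorn's lemma applies.\<close>

lemma proper_left_ideal_in_max:
  assumes L: "cp_left_ideal G S f L" "scal 1 \<notin> L"
  obtains L' where "cp_max_left_ideal G S f L'" "L \<subseteq> L'" "scal 1 \<notin> L'"
proof -
  define \<A> where "\<A> = {L'. cp_left_ideal G S f L' \<and> scal 1 \<notin> L' \<and> L \<subseteq> L'}"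
  have "\<exists>M\<in>\<A>. \<forall>X\<in>\<A>. M \<subseteq> X \<longrightarrow> X = M"
  proof (rule subset_Zorn_nonempty)
    show "\<A> \<noteq> {}" using L by (auto simp: \<A>_def)
    fix \<C> assume ne: "\<C> \<noteq> {}" and ch: "subset.chain \<A> \<C>"
    have C: "\<C> \<subseteq> \<A>" and tot: "\<And>X Y. X \<in> \<C> \<Longrightarrow> Y \<in> \<C> \<Longrightarrow> X \<subseteq> Y \<or> Y \<subseteq> X"
      using ch by (auto simp: subset_chain_def)
    have CL: "cp_left_ideal G S f X" if "X \<in> \<C>" for X using C that by (auto simp: \<A>_def)
    have "cp_left_ideal G S f (\<Union>\<C>)"
      unfolding cp_left_ideal_def
    proof (intro conjI ballI)
      show "\<Union>\<C> \<subseteq> A" using left_idealD(1)[OF CL] by blast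
      show "(\<lambda>_. 0) \<in> \<Union>\<C>" using ne left_idealD(2)[OF CL] by blast
      fix x y assume "x \<in> \<Union>\<C>" "y \<in> \<Union>\<C>"
      then obtain X Y where "x \<in> X" "X \<in> \<C>" "y \<in> Y" "Y \<in> \<C>" by blast
      then obtain W where "x \<in> W" "y \<in> W" "W \<in> \<C>" using tot by blast
      thus "(\<lambda>\<rho>. x \<rho> + y \<rho>) \<in> \<Union>\<C>" using left_idealD(3)[OF CL] by blast
    next
      fix a x assume "a \<in> A" "x \<in> \<Union>\<C>"
      thus "cp_mult G f a x \<in> \<Union>\<C>" using left_idealD(4)[OF CL] by blast
    qed
    moreover have "scal 1 \<notin> \<Union>\<C>" "L \<subseteq> \<Union>\<C>" using C ne by (auto simp: \<A>_def)
    ultimately show "\<Union>\<C> \<in> \<A>" by (simp add: \<A>_def)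
  qed
  then obtain L' where L': "L' \<in> \<A>" "\<And>X. X \<in> \<A> \<Longrightarrow> L' \<subseteq> X \<Longrightarrow> X = L'" by blast
  have "cp_max_left_ideal G S f L'"
    unfolding cp_max_left_ideal_def
  proof (intro conjI allI impI)
    show "cp_left_ideal G S f L'" using L' by (simp add: \<A>_def)
    thus "L' \<noteq> A" using L' left_ideal_eq_A_iff by (simp add: \<A>_def)
    fix X assume X: "cp_left_ideal G S f X \<and> L' \<subseteq> X"
    show "X = L' \<or> X = A"
    proof (cases "scal 1 \<in> X")
      case True
      thus ?thesis using left_ideal_eq_A_iff X by blast
    next
      case False
      hence "X \<in> \<A>" using X L'(1) by (auto simp: \<A>_def)
      thus ?thesis using L'(2) X by blast
    qed
  qed
  thus ?thesis using that L'(1) by (simp add: \<A>_def)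
qed

text \<open>This is A_f N in coordinates: moving an element n of N to the left past the basis
  element of \<sigma> turns it into \<sigma>(n). Left multiplication respects the description
  because \<sigma> maps the image of N under \<open>inv \<sigma> \<circ> \<rho>\<close> to its image
  under \<rho>.\<close>

lemma left_ideal_of_max_ideal:
  assumes N: "max_ideal_of S N"
  shows "cp_left_ideal G S f {a \<in> A. \<forall>\<sigma>\<in>G. a \<sigma> \<in> \<sigma> ` N}" (is "cp_left_ideal G S f ?L")
  unfolding cp_left_ideal_def
proof (intro conjI ballI)
  have oN: "max_ideal_of S (\<sigma> ` N)" if "\<sigma> \<in> G" for \<sigma> using max_ideal_image[OF that N] .
  show "?L \<subseteq> A" by blast
  show "(\<lambda>_. 0) \<in> ?L" using max_idealD(2)[OF oN] SD(1) by (auto simp: cp_carrier_def)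
  show "(\<lambda>\<rho>. x \<rho> + y \<rho>) \<in> ?L" if "x \<in> ?L" "y \<in> ?L" for x y
    using that add_A max_idealD(3)[OF oN] by simp
  fix a x assume a: "a \<in> A" and x: "x \<in> ?L"
  have "cp_mult G f a x \<rho> \<in> \<rho> ` N" if r: "\<rho> \<in> G" for \<rho>
  proof -
    have "a \<sigma> * \<sigma> (x (inv \<sigma> \<circ> \<rho>)) * f \<sigma> (inv \<sigma> \<circ> \<rho>) \<in> \<rho> ` N" if s: "\<sigma> \<in> G" for \<sigma>
    proof -
      have "x (inv \<sigma> \<circ> \<rho>) \<in> (inv \<sigma> \<circ> \<rho>) ` N" using x s r comp_G inv_G by blast
      hence "\<sigma> (x (inv \<sigma> \<circ> \<rho>)) \<in> \<sigma> ` (inv \<sigma> \<circ> \<rho>) ` N" by blast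
      also have "\<sigma> ` (inv \<sigma> \<circ> \<rho>) ` N = \<rho> ` N" by (simp only: image_comp comp_inv_cancel[OF s])
      finally show ?thesis
        using max_idealD(5)[OF oN[OF r] f_S[OF s comp_G[OF inv_G[OF s] r]] max_idealD(4)[OF oN[OF r] A_app[OF a]]]
        by blast
    qed
    thus ?thesis using r by (simp add: cp_mult_def max_ideal_sum[OF oN[OF r]])
  qed
  thus "cp_mult G f a x \<in> ?L" using a x cp_mult_A by simp
qed

text \<open>By transitivity the other maximal ideals are the finitely many conjugates of N different
  from N. None of them is contained in N, so the product of one element from each, chosen outside N,
  works because N is prime.\<close>

lemma separating_element:
  assumes N: "max_ideal_of S N"
  obtains e where "e \<in> S" "e \<notin> N" "\<And>M. max_ideal_of S M \<Longrightarrow> M \<noteq> N \<Longrightarrow> e \<in> M"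
proof -
  define W where "W = {\<omega> \<in> G. \<omega> ` N \<noteq> N}"
  have fin: "finite W" using finite_G by (simp add: W_def)
  have "\<exists>m. m \<in> \<omega> ` N \<and> m \<notin> N" if "\<omega> \<in> W" for \<omega>
    using that max_ideal_subset_eq[OF max_ideal_image[OF _ N] N] by (auto simp: W_def)
  then obtain m where m: "\<And>\<omega>. \<omega> \<in> W \<Longrightarrow> m \<omega> \<in> \<omega> ` N" "\<And>\<omega>. \<omega> \<in> W \<Longrightarrow> m \<omega> \<notin> N" by metis
  have mS: "m \<omega> \<in> S" if "\<omega> \<in> W" for \<omega>
    using that m(1)[OF that] max_idealD(1)[OF max_ideal_image[OF _ N], of \<omega>] unfolding W_def by blast
  show ?thesis
  proof (rule that[of "prod m W"])
    show "prod m W \<in> S" using mS by (rule subring_set_prod[OF subring_S])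
    show "prod m W \<notin> N" using max_ideal_prod[OF N fin, of m] m(2) mS by blast
    fix M assume M: "max_ideal_of S M" "M \<noteq> N"
    obtain \<omega> where "\<omega> \<in> G" "M = \<omega> ` N" using max_ideal_transitive[OF M(1) N] .
    hence "\<omega> \<in> W" "m \<omega> \<in> M" using M m(1) by (auto simp: W_def)
    thus "prod m W \<in> M" using max_ideal_prod[OF M(1) fin, of m] mS by blast
  qed
qed

text \<open>The largest two-sided ideal whose elements have their coefficient at the identity in M.\<close>
definition trace_ideal :: "'k set \<Rightarrow> (('k \<Rightarrow> 'k) \<Rightarrow> 'k) set" where
  "trace_ideal M = {a \<in> A. \<forall>b\<in>A. \<forall>c\<in>A. cp_mult G f (cp_mult G f b a) c id \<in> M}"

text \<open>Associativity absorbs an additional left factor into b and an additional right factor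
  into c.\<close>

lemma trace_ideal_ideal:
  assumes M: "max_ideal_of S M"
  shows "cp_ideal G S f (trace_ideal M)"
  unfolding cp_ideal_def cp_left_ideal_def
proof (intro conjI ballI)
  show "trace_ideal M \<subseteq> A" by (auto simp: trace_ideal_def)
  have "cp_mult G f b (\<lambda>_. 0) = (\<lambda>_. 0)" for b
    by (auto simp: cp_mult_def fun_eq_iff aut_0 intro!: sum.neutral)
  moreover have "cp_mult G f (\<lambda>_. 0) c = (\<lambda>_. 0)" for c
    by (auto simp: cp_mult_def fun_eq_iff)
  ultimately show "(\<lambda>_. 0) \<in> trace_ideal M"
    using SD(1) max_idealD(2)[OF M] by (auto simp: trace_ideal_def cp_carrier_def)
  show "(\<lambda>\<rho>. x \<rho> + y \<rho>) \<in> trace_ideal M" if "x \<in> trace_ideal M" "y \<in> trace_ideal M" for x y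
    using that max_idealD(3)[OF M]
    by (simp add: trace_ideal_def add_A cp_mult_add_right cp_mult_add_left)
  fix a x assume ax: "a \<in> A" "x \<in> trace_ideal M"
  have x: "x \<in> A" "\<And>b c. b \<in> A \<Longrightarrow> c \<in> A \<Longrightarrow> cp_mult G f (cp_mult G f b x) c id \<in> M"
    using ax by (auto simp: trace_ideal_def)
  have "cp_mult G f (cp_mult G f b (cp_mult G f a x)) c id \<in> M" if "b \<in> A" "c \<in> A" for b c
    unfolding cp_mult_assoc[of b a x, symmetric] using that ax(1) by (intro x cp_mult_A)
  thus "cp_mult G f a x \<in> trace_ideal M" using ax x by (simp add: trace_ideal_def cp_mult_A)
  have "cp_mult G f (cp_mult G f b (cp_mult G f x a)) c id \<in> M" if "b \<in> A" "c \<in> A" for b c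
    unfolding cp_mult_assoc[of b x a, symmetric] cp_mult_assoc[of "cp_mult G f b x" a c]
    using that ax(1) by (intro x cp_mult_A)
  thus "cp_mult G f x a \<in> trace_ideal M" using ax x by (simp add: trace_ideal_def cp_mult_A)
qed

lemma scal_1_notin_trace_ideal:
  assumes M: "max_ideal_of S M"
  shows "scal 1 \<notin> trace_ideal M"
proof
  assume "scal 1 \<in> trace_ideal M"
  moreover have "scal 1 \<in> A" using scal_A SD(2) by blast
  ultimately have "cp_mult G f (cp_mult G f (scal 1) (scal 1)) (scal 1) id \<in> M" by (simp add: trace_ideal_def)
  moreover have "cp_mult G f (scal 1) (scal 1) = scal 1"
    by (simp add: cp_mult_scal_left[OF \<open>scal 1 \<in> A\<close>])
  moreover have "scal 1 id = 1" by (simp add: scal_def)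
  ultimately show False using max_idealD(6)[OF M] by metis
qed

text \<open>In the coefficient at \<open>id\<close> of the product of b, e and c, the summand for
  \<sigma> contains both \<open>\<sigma> e\<close> and \<open>f \<sigma> (inv \<sigma>)\<close>, so
  it suffices that one of them lies in M.\<close>

lemma scal_in_trace_ideal:
  assumes M: "max_ideal_of S M" and e: "e \<in> S"
    and *: "\<And>\<sigma>. \<sigma> \<in> G \<Longrightarrow> \<sigma> e \<in> M \<or> f \<sigma> (inv \<sigma>) \<in> M"
  shows "scal e \<in> trace_ideal M"
proof -
  have "cp_mult G f (cp_mult G f b (scal e)) c id \<in> M" if bc: "b \<in> A" "c \<in> A" for b c
  proof -
    have "b \<sigma> * \<sigma> e * \<sigma> (c (inv \<sigma>)) * f \<sigma> (inv \<sigma>) \<in> M" if s: "\<sigma> \<in> G" for \<sigma>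
    proof (cases "\<sigma> e \<in> M")
      case True
      from max_idealD(4)[OF M A_app[OF bc(1)] this] show ?thesis
        by (rule max_idealD(5)[OF M f_S[OF s inv_G[OF s]] max_idealD(5)[OF M aut_S[OF s A_app[OF bc(2)]]]])
    next
      case False
      hence "f \<sigma> (inv \<sigma>) \<in> M" using *[OF s] by simp
      moreover have "b \<sigma> * \<sigma> e * \<sigma> (c (inv \<sigma>)) \<in> S"
        by (rule SD(4)[OF SD(4)[OF A_app[OF bc(1)] aut_S[OF s e]] aut_S[OF s A_app[OF bc(2)]]])
      ultimately show ?thesis by (rule max_idealD(4)[OF M, rotated])
    qed
    thus ?thesis unfolding cp_mult_scal_right[OF bc(1)]
      using id_G by (simp add: cp_mult_def max_ideal_sum[OF M])
  qed
  thus ?thesis using e scal_A by (simp add: trace_ideal_def)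
qed

section \<open>Consequences of primariness\<close>

lemma cp_ideal_add:
  assumes I: "cp_ideal G S f I" and J: "cp_ideal G S f J"
  shows "cp_ideal G S f {(\<lambda>\<rho>. x \<rho> + y \<rho>) | x y. x \<in> I \<and> y \<in> J}" (is "cp_ideal G S f ?K")
proof -
  have lI: "cp_left_ideal G S f I" and rI: "\<And>a x. a \<in> A \<Longrightarrow> x \<in> I \<Longrightarrow> cp_mult G f x a \<in> I"
    and lJ: "cp_left_ideal G S f J" and rJ: "\<And>a x. a \<in> A \<Longrightarrow> x \<in> J \<Longrightarrow> cp_mult G f x a \<in> J"
    using I J by (auto simp: cp_ideal_def)
  note ID = left_idealD[OF lI] and JD = left_idealD[OF lJ]
  have KI: "z \<in> ?K" if "x \<in> I" "y \<in> J" "z = (\<lambda>\<rho>. x \<rho> + y \<rho>)" for x y z using that by blast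
  show ?thesis
    unfolding cp_ideal_def cp_left_ideal_def
  proof (intro conjI ballI)
    show "?K \<subseteq> A" using ID(1) JD(1) add_A by blast
    show "(\<lambda>_. 0) \<in> ?K" by (rule KI[OF ID(2) JD(2)]) simp
    fix z z' assume "z \<in> ?K" "z' \<in> ?K"
    then obtain x y x' y' where "x \<in> I" "y \<in> J" "z = (\<lambda>\<rho>. x \<rho> + y \<rho>)" "x' \<in> I" "y' \<in> J" "z' = (\<lambda>\<rho>. x' \<rho> + y' \<rho>)"
      by blast
    thus "(\<lambda>\<rho>. z \<rho> + z' \<rho>) \<in> ?K"
      by (intro KI[OF ID(3)[of x x'] JD(3)[of y y']]) (auto simp: algebra_simps)
  next
    fix a z assume a: "a \<in> A" and "z \<in> ?K"
    then obtain x y where xy: "x \<in> I" "y \<in> J" "z = (\<lambda>\<rho>. x \<rho> + y \<rho>)" by blast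
    show "cp_mult G f a z \<in> ?K"
      by (rule KI[OF ID(4)[OF a xy(1)] JD(4)[OF a xy(2)]]) (simp add: xy(3) cp_mult_add_right)
    show "cp_mult G f z a \<in> ?K"
      by (rule KI[OF rI[OF a xy(1)] rJ[OF a xy(2)]]) (simp add: xy(3) cp_mult_add_left)
  qed
qed

lemma primary_transport:
  assumes prim: "primary_cp G S f" and M: "max_ideal_of S M" and N: "max_ideal_of S N"
  obtains \<sigma> where "\<sigma> \<in> G" "\<sigma> ` N = M" "f \<sigma> (inv \<sigma>) \<notin> M"
proof (rule ccontr)
  assume "\<not> thesis"
  hence bad: "f \<sigma> (inv \<sigma>) \<in> M" if "\<sigma> \<in> G" "\<sigma> ` N = M" for \<sigma>
    using that \<open>\<And>\<sigma>. \<sigma> \<in> G \<Longrightarrow> \<sigma> ` N = M \<Longrightarrow> f \<sigma> (inv \<sigma>) \<notin> M \<Longrightarrow> thesis\<close> by blast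
  obtain e where e: "e \<in> S" "e \<notin> N" "\<And>M. max_ideal_of S M \<Longrightarrow> M \<noteq> N \<Longrightarrow> e \<in> M"
    using separating_element[OF N] by blast
  let ?I = "trace_ideal M" and ?J = "cp_jacobson G S f"
  have I: "cp_ideal G S f ?I" using trace_ideal_ideal[OF M] .
  hence lI: "cp_left_ideal G S f ?I" by (simp add: cp_ideal_def)
  have J: "cp_ideal G S f ?J" and maxJ: "\<And>I'. cp_ideal G S f I' \<Longrightarrow> ?J \<subseteq> I' \<Longrightarrow> I' = ?J \<or> I' = A"
    using prim by (auto simp: primary_cp_def cp_max_ideal_def)
  hence lJ: "cp_left_ideal G S f ?J" by (simp add: cp_ideal_def)
  have eI: "scal e \<in> ?I"
  proof (rule scal_in_trace_ideal[OF M e(1)])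
    fix \<sigma> assume s: "\<sigma> \<in> G"
    show "\<sigma> e \<in> M \<or> f \<sigma> (inv \<sigma>) \<in> M"
    proof (cases "\<sigma> ` N = M")
      \<comment> \<open>If \<sigma> does not carry N to M, then \<open>inv \<sigma>\<close> applied
        to M is a maximal ideal other than N and contains e; applying \<sigma> puts
        \<open>\<sigma> e\<close> into M.\<close>
      case False
      hence "inv \<sigma> ` M \<noteq> N" using image_image_inv(1)[OF s] by metis
      hence "e \<in> inv \<sigma> ` M" using e(3) max_ideal_image[OF inv_G[OF s] M] by blast
      thus ?thesis using image_iff_inv[OF inv_G[OF s]] inv_inv_G[OF s] by simp
    qed (use bad s in blast)
  qed
  \<comment> \<open>Some maximal left ideal contains the trace ideal, and it contains the radical as
    well, so the sum stays proper. Maximality of the radical among two-sided ideals then forces the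
    trace ideal into it.\<close>
  define K where "K = {(\<lambda>\<rho>. x \<rho> + y \<rho>) | x y. x \<in> ?I \<and> y \<in> ?J}"
  have K: "cp_ideal G S f K" unfolding K_def using cp_ideal_add[OF I J] .
  have KI: "z \<in> K" if "x \<in> ?I" "y \<in> ?J" "z = (\<lambda>\<rho>. x \<rho> + y \<rho>)" for x y z using that unfolding K_def by blast
  have JK: "?J \<subseteq> K" using KI[OF left_idealD(2)[OF lI]] by auto
  have IK: "?I \<subseteq> K" using KI[OF _ left_idealD(2)[OF lJ]] by auto
  obtain L where L: "cp_max_left_ideal G S f L" "?I \<subseteq> L" "scal 1 \<notin> L"
    using proper_left_ideal_in_max[OF lI scal_1_notin_trace_ideal[OF M]] .
  have lL: "cp_left_ideal G S f L" using L(1) by (simp add: cp_max_left_ideal_def)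
  have "?J \<subseteq> L" using L(1) by (auto simp: cp_jacobson_def)
  hence "K \<subseteq> L" unfolding K_def using L(2) left_idealD(3)[OF lL] by blast
  hence "K \<noteq> A" using L(3) scal_A[OF SD(2)] by blast
  hence "K = ?J" using maxJ[OF K JK] by blast
  hence eJ: "scal e \<in> ?J" using IK eI by blast
  let ?L = "{a \<in> A. \<forall>\<sigma>\<in>G. a \<sigma> \<in> \<sigma> ` N}"
  have "scal 1 \<notin> ?L" using id_G max_idealD(6)[OF N] by (auto simp: scal_def)
  then obtain L' where L': "cp_max_left_ideal G S f L'" "?L \<subseteq> L'" "scal 1 \<notin> L'"
    using proper_left_ideal_in_max[OF left_ideal_of_max_ideal[OF N]] by blast
  have lL': "cp_left_ideal G S f L'" using L'(1) by (simp add: cp_max_left_ideal_def)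
  have eL: "scal e \<in> L'" using eJ L'(1) by (auto simp: cp_jacobson_def)
  \<comment> \<open>The inverse of e modulo N writes \<open>scal 1\<close> as a multiple of
    \<open>scal e\<close>, which is in the radical, plus \<open>scal n\<close>, which is in A_f N.
    Both lie in the proper left ideal \<open>L'\<close>.\<close>
  obtain s n where sn: "s \<in> S" "n \<in> N" "1 = s * e + n" using max_ideal_inverse_mod[OF N e(1,2)] .
  have nS: "n \<in> S" using sn max_idealD(1)[OF N] by blast
  have "scal n \<sigma> \<in> \<sigma> ` N" if "\<sigma> \<in> G" for \<sigma>
    using sn(2) max_idealD(2)[OF max_ideal_image[OF that N]] by (simp add: scal_def)
  hence "scal n \<in> L'" using L'(2) scal_A[OF nS] by blast
  hence "(\<lambda>\<rho>. cp_mult G f (scal s) (scal e) \<rho> + scal n \<rho>) \<in> L'"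
    using left_idealD(3,4)[OF lL'] eL scal_A[OF sn(1)] by blast
  also have "(\<lambda>\<rho>. cp_mult G f (scal s) (scal e) \<rho> + scal n \<rho>) = scal 1"
    unfolding cp_mult_scal_left[OF scal_A[OF e(1)]] using sn(3) by (auto simp: scal_def fun_eq_iff)
  finally show False using L'(3) by simp
qed

text \<open>Transport from N to its image under \<open>inv \<tau>\<close> gives \<sigma> such that
  \<open>\<tau> \<circ> \<sigma>\<close> stabilizes N, and the value testing its equivalence with
  \<tau> is exactly \<open>f (inv \<sigma>) \<sigma>\<close>.\<close>

lemma surj_if_primary:
  assumes prim: "primary_cp G S f" and N: "max_ideal_of S N"
  shows "\<forall>\<tau>\<in>G. \<exists>d\<in>decomp_group G S N. eqM N d \<tau>"
proof
  fix \<tau> assume t: "\<tau> \<in> G"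
  obtain \<sigma> where s: "\<sigma> \<in> G" "\<sigma> ` N = inv \<tau> ` N" "f \<sigma> (inv \<sigma>) \<notin> inv \<tau> ` N"
    using primary_transport[OF prim max_ideal_image[OF inv_G[OF t] N] N] .
  have "(\<tau> \<circ> \<sigma>) ` N = N" by (simp only: image_comp[symmetric] s(2) image_image_inv(1)[OF t])
  hence d: "\<tau> \<circ> \<sigma> \<in> decomp_group G S N" using s t by (simp add: decomp_group_iff[OF N] comp_G)
  have "f (inv \<sigma>) \<sigma> \<notin> N" using s f_inv_image by metis
  hence "eqM N (\<tau> \<circ> \<sigma>) \<tau>" using eqM_Z_iff[OF N d t] s t by (simp add: G_simps)
  thus "\<exists>d\<in>decomp_group G S N. eqM N d \<tau>" using d by blast
qed

text \<open>\<open>GrSup\<close> at N serves as the hub: translation connects it with each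
  \<open>GrSup\<close>, and psi connects each \<open>GrSub\<close> with the \<open>GrSup\<close> at
  the same ideal.\<close>

lemma graphs_isomorphic:
  assumes N: "max_ideal_of S N" and surj: "\<forall>\<tau>\<in>G. \<exists>d\<in>decomp_group G S N. eqM N d \<tau>"
    and M: "max_ideal_of S M" and M': "max_ideal_of S M'"
  shows "graph_isomorphic (GrSup G S f M) (GrSup G S f M')"
    and "graph_isomorphic (GrSup G S f M) (GrSub G S f M')"
    and "graph_isomorphic (GrSub G S f M) (GrSub G S f M')"
proof -
  have sup: "graph_isomorphic (GrSup G S f N) (GrSup G S f L)" if "max_ideal_of S L" for L
    using surj_transfer(1)[OF that N surj] .
  have "graph_iso (psiM G S f L) (GrSub G S f L) (GrSup G S f L)" if "max_ideal_of S L" for L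
    using psi_iso_iff[OF that] surj_transfer(2)[OF that N surj] by blast
  hence sub: "graph_isomorphic (GrSub G S f L) (GrSup G S f L)" if "max_ideal_of S L" for L
    unfolding graph_isomorphic_def using that by blast
  show 1: "graph_isomorphic (GrSup G S f M) (GrSup G S f M')"
    using graph_isomorphic_trans[OF graph_isomorphic_sym[OF sup[OF M]] sup[OF M']] .
  show 2: "graph_isomorphic (GrSup G S f M) (GrSub G S f M')"
    using graph_isomorphic_trans[OF 1 graph_isomorphic_sym[OF sub[OF M']]] .
  show "graph_isomorphic (GrSub G S f M) (GrSub G S f M')"
    using graph_isomorphic_trans[OF sub[OF M] 2] .
qed

end

theorem theorem5p1:
  fixes G :: "('k::field \<Rightarrow> 'k) set" and V :: "'k set"
    and f :: "('k \<Rightarrow> 'k) \<Rightarrow> ('k \<Rightarrow> 'k) \<Rightarrow> 'k" and N :: "'k set"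
  assumes G: "aut_group G"
    and V: "valuation_domain_of (fixfield G) V"
    and f: "norm_cocycle G (int_closure V) f"
    and N: "max_ideal_of (int_closure V) N"
  shows
    "(graph_iso (psiM G (int_closure V) f N) (GrSub G (int_closure V) f N) (GrSup G (int_closure V) f N)
        \<longleftrightarrow> (\<exists>R. right_coset_reps G (decomp_group G (int_closure V) N) R
                 \<and> (\<forall>\<rho>\<in>R. f \<rho> (inv \<rho>) \<notin> N)))
     \<and> (graph_iso (psiM G (int_closure V) f N) (GrSub G (int_closure V) f N) (GrSup G (int_closure V) f N)
        \<longrightarrow> phi_well_defined G (int_closure V) f N
          \<and> graph_epi (phiN G (int_closure V) f N) (Gr G (int_closure V) f) (GrSub G (int_closure V) f N)
          \<and> (\<forall>X\<in>fst (Gr G (int_closure V) f).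
               psiM G (int_closure V) f N (phiN G (int_closure V) f N X) = cM G (int_closure V) f N X))
     \<and> (\<forall>M. graph_iso (psiM G (int_closure V) f N) (GrSub G (int_closure V) f N) (GrSup G (int_closure V) f N)
           \<and> max_ideal_of (int_closure V) M \<longrightarrow>
          graph_isomorphic (GrSup G (int_closure V) f M) (GrSup G (int_closure V) f N)
        \<and> graph_isomorphic (GrSup G (int_closure V) f M) (GrSub G (int_closure V) f M)
        \<and> graph_isomorphic (GrSup G (int_closure V) f M) (GrSub G (int_closure V) f N)
        \<and> graph_isomorphic (GrSup G (int_closure V) f N) (GrSub G (int_closure V) f M)
        \<and> graph_isomorphic (GrSup G (int_closure V) f N) (GrSub G (int_closure V) f N)
        \<and> graph_isomorphic (GrSub G (int_closure V) f M) (GrSub G (int_closure V) f N)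
        \<and> graph_iso (psiM G (int_closure V) f M) (GrSub G (int_closure V) f M) (GrSup G (int_closure V) f M))
     \<and> (tame_defectless G V \<and> primary_cp G (int_closure V) f \<longrightarrow>
          graph_iso (psiM G (int_closure V) f N) (GrSub G (int_closure V) f N) (GrSup G (int_closure V) f N)
        \<and> (\<forall>X\<in>fst (Gr G (int_closure V) f).
               psiM G (int_closure V) f N (phiN G (int_closure V) f N X) = cM G (int_closure V) f N X)
        \<and> (\<forall>M M'. max_ideal_of (int_closure V) M \<and> max_ideal_of (int_closure V) M' \<longrightarrow>
              graph_isomorphic (GrSup G (int_closure V) f M) (GrSup G (int_closure V) f M')
            \<and> graph_isomorphic (GrSub G (int_closure V) f M) (GrSub G (int_closure V) f M')
            \<and> graph_isomorphic (GrSup G (int_closure V) f M) (GrSub G (int_closure V) f M')))"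
proof -
  let ?S = "int_closure V"
  interpret galois_cocycle G V f by unfold_locales (fact G V f)+
  let ?surj = "\<forall>\<sigma>\<in>G. \<exists>d\<in>decomp_group G ?S N. eqM N d \<sigma>"
  have iso: "graph_iso (psiM G ?S f N) (GrSub G ?S f N) (GrSup G ?S f N) \<longleftrightarrow> ?surj"
    using psi_iso_iff[OF N] .
  have psi: "graph_iso (psiM G ?S f M) (GrSub G ?S f M) (GrSup G ?S f M)" if ?surj "max_ideal_of ?S M" for M
    using psi_iso_iff[OF that(2)] surj_transfer(2)[OF that(2) N that(1)] by blast
  note iso_all = graphs_isomorphic[OF N]
  \<comment> \<open>Rewriting with \<open>iso\<close> turns the isomorphism statement for N,
    wherever it occurs, into the surjectivity condition on which the auxiliary results rest.\<close>
  show ?thesis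
    unfolding iso
  proof (intro conjI allI impI)
    show "?surj \<longleftrightarrow> (\<exists>R. right_coset_reps G (decomp_group G ?S N) R \<and> (\<forall>\<rho>\<in>R. f \<rho> (inv \<rho>) \<notin> N))"
      using right_coset_reps_iff[OF N] by blast
  next
    assume ?surj
    thus "phi_well_defined G ?S f N" "graph_epi (phiN G ?S f N) (Gr G ?S f) (GrSub G ?S f N)"
      "\<forall>X\<in>fst (Gr G ?S f). psiM G ?S f N (phiN G ?S f N X) = cM G ?S f N X"
      using phi_well_defined[OF N] phi_epi[OF N] psi_phi_eq_c[OF N] by blast+
  next
    fix M assume "?surj \<and> max_ideal_of ?S M"
    hence s: ?surj and M: "max_ideal_of ?S M" by blast+
    show "graph_isomorphic (GrSup G ?S f M) (GrSup G ?S f N)" "graph_isomorphic (GrSup G ?S f M) (GrSub G ?S f M)"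
      "graph_isomorphic (GrSup G ?S f M) (GrSub G ?S f N)" "graph_isomorphic (GrSup G ?S f N) (GrSub G ?S f M)"
      "graph_isomorphic (GrSup G ?S f N) (GrSub G ?S f N)" "graph_isomorphic (GrSub G ?S f M) (GrSub G ?S f N)"
      by (rule iso_all[OF s]; fact M N)+
    show "graph_iso (psiM G ?S f M) (GrSub G ?S f M) (GrSup G ?S f M)" using psi[OF s M] .
  next
    assume "tame_defectless G V \<and> primary_cp G ?S f"
    thus s: ?surj using surj_if_primary[OF _ N] by blast
    show "\<forall>X\<in>fst (Gr G ?S f). psiM G ?S f N (phiN G ?S f N X) = cM G ?S f N X"
      using psi_phi_eq_c[OF N s] by blast
    fix M M' assume "max_ideal_of ?S M \<and> max_ideal_of ?S M'"
    thus "graph_isomorphic (GrSup G ?S f M) (GrSup G ?S f M')" "graph_isomorphic (GrSub G ?S f M) (GrSub G ?S f M')"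
      "graph_isomorphic (GrSup G ?S f M) (GrSub G ?S f M')"
      using iso_all[OF s] by blast+
  qed
qed

end
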